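(* Let $(M,\partial M,g)$ be a Riemannian $3$-manifold with nonempty boundary, let $q\in\partial M$, and let $B_r(q)$ be the Fermi coordinate ball of radius $r$ centred at $q$ with interior boundary $S_r^+$. Then, as $r\to0^+$, $$\int_{S_r^+}H^2\,d\sigma=8\pi-4\pi H_0\,r+O(r^2),$$ where on the left $H$ is the mean curvature of $S_r^+$ and $H_0$ is the mean curvature of $\partial M$ at $q$. In particular, if $H_0>0$, then $\int_{S_r^+}H^2\,d\sigma<8\pi$ for all sufficiently small $r$.
   Context: $\mathbf{n}$ is the inward unit normal of $\partial M$, $\operatorname{II}(X,Y)=\langle\nabla_XY,\mathbf{n}\rangle$, and the mean curvature of $\partial M$ is $\operatorname{tr}\operatorname{II}$ (so it is nonnegative for convex boundary). Fermi coordinates $(x^1,x^2,y)$ at $q\in\partial M$: $(x^1,x^2)$ are geodesic normal coordinates on $\partial M$ centred at $q$ (with respect to an orthonormal frame of $T_q\partial M$), and the point with coordinates $(x,y)$, $y\ge0$, is reached by following for distance $y$ the unit-speed geodesic of $M$ starting at the boundary point with coordinates $x$ in direction $\mathbf{n}$. Thus $\partial M=\{y=0\}$ and $g=g_{ij}(x,y)\,dx^idx^j+dy^2$. For small $r>0$, $B_r(q)=\{(x,y)\in M:|x|^2+y^2<r^2\}$ and $S_r^+=\{(x,y)\in M:|x|^2+y^2=r^2\}$, where $|x|^2=(x^1)^2+(x^2)^2$. *)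

theory Defs
  imports "HOL-Analysis.Analysis" "HOL-Library.Landau_Symbols"
begin

text \<open>For open \<open>S\<close>: \<open>f\<close> is of class \<open>C\<^sup>k\<close> on \<open>S\<close>.\<close>

primrec Ck_on :: "nat \<Rightarrow> ('a::real_normed_vector \<Rightarrow> 'b::real_normed_vector) \<Rightarrow> 'a set \<Rightarrow> bool" where
  "Ck_on 0 f S \<longleftrightarrow> continuous_on S f"
| "Ck_on (Suc k) f S \<longleftrightarrow>
     f differentiable_on S \<and> (\<forall>v. Ck_on k (\<lambda>x. frechet_derivative f (at x) v) S)"

text \<open>Smoothness on an arbitrary set (here: relatively open subsets of a half-space) means, as
  usual, local extendability to a smooth map on an open set.\<close>

definition smooth_on :: "('a::real_normed_vector \<Rightarrow> 'b::real_normed_vector) \<Rightarrow> 'a set \<Rightarrow> bool" where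
  "smooth_on f S \<longleftrightarrow>
     (\<forall>x\<in>S. \<exists>V F. open V \<and> x \<in> V \<and> (\<forall>k. Ck_on k F V) \<and> (\<forall>z\<in>V \<inter> S. F z = f z))"

text \<open>The \<open>i\<close>-th partial derivative of a map defined on \<open>S\<close>; at boundary points of a half-space
  the derivative in the normal direction is the one-sided one.\<close>

definition partial_on :: "(real^'n) set \<Rightarrow> (real^'n \<Rightarrow> 'b::real_normed_vector) \<Rightarrow> 'n \<Rightarrow> real^'n \<Rightarrow> 'b" where
  "partial_on S f i x =
     vector_derivative (\<lambda>t. f (x + t *\<^sub>R axis i 1)) (at 0 within {t. x + t *\<^sub>R axis i 1 \<in> S})"

definition ip :: "real^'n^'n \<Rightarrow> real^'n \<Rightarrow> real^'n \<Rightarrow> real" where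
  "ip M v w = v \<bullet> (M *v w)"

definition christoffel ::
  "(real^'n) set \<Rightarrow> (real^'n \<Rightarrow> real^'n^'n) \<Rightarrow> 'n \<Rightarrow> 'n \<Rightarrow> 'n \<Rightarrow> real^'n \<Rightarrow> real" where
  "christoffel S g k i j x =
     (1/2) * (\<Sum>l\<in>UNIV. matrix_inv (g x) $ k $ l *
        (partial_on S (\<lambda>z. g z $ j $ l) i x + partial_on S (\<lambda>z. g z $ i $ l) j x
         - partial_on S (\<lambda>z. g z $ i $ j) l x))"

text \<open>The coordinate curve \<open>u\<close>, defined on the interval \<open>I\<close>, satisfies the geodesic equation of
  the metric \<open>g\<close> on \<open>S\<close> at time \<open>t\<close>.\<close>

definition geodesic_eq_at ::
  "(real^'n) set \<Rightarrow> (real^'n \<Rightarrow> real^'n^'n) \<Rightarrow> real set \<Rightarrow> (real \<Rightarrow> real^'n) \<Rightarrow> real \<Rightarrow> bool" where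
  "geodesic_eq_at S g I u t \<longleftrightarrow>
     (let u' = (\<lambda>s. vector_derivative u (at s within I)) in
       u differentiable (at t within I) \<and>
       (\<forall>\<^sub>F s in at t within I. u differentiable (at s within I)) \<and>
       (u' has_vector_derivative
          (\<chi> k. - (\<Sum>i\<in>UNIV. \<Sum>j\<in>UNIV. christoffel S g k i j (u t) * u' t $ i * u' t $ j)))
         (at t within I))"

text \<open>The third coordinate is the coordinate \<open>y\<close> of the half-space.\<close>

definition half_space :: "(real^3) set" where
  "half_space = {v. v $ 3 \<ge> 0}"

type_synonym 'a chart = "'a set \<times> ('a \<Rightarrow> real^3)"

definition image_of :: "'a chart \<Rightarrow> (real^3) set" where
  "image_of c = snd c ` fst c"

definition chart_inv :: "'a chart \<Rightarrow> real^3 \<Rightarrow> 'a" where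
  "chart_inv c = inv_into (fst c) (snd c)"

definition is_chart :: "'a::topological_space chart \<Rightarrow> bool" where
  "is_chart c \<longleftrightarrow>
     open (fst c) \<and> openin (top_of_set half_space) (image_of c) \<and>
     homeomorphism (fst c) (image_of c) (snd c) (chart_inv c)"

definition transition :: "'a chart \<Rightarrow> 'a chart \<Rightarrow> real^3 \<Rightarrow> real^3" where
  "transition c d = snd d \<circ> chart_inv c"

definition compatible :: "'a chart \<Rightarrow> 'a chart \<Rightarrow> bool" where
  "compatible c d \<longleftrightarrow>
     smooth_on (transition c d) (snd c ` (fst c \<inter> fst d)) \<and>
     smooth_on (transition d c) (snd d ` (fst c \<inter> fst d))"

definition smooth_structure :: "'a::topological_space chart set \<Rightarrow> bool" where
  "smooth_structure A \<longleftrightarrow>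
     (\<forall>c\<in>A. is_chart c) \<and> (\<Union>c\<in>A. fst c) = UNIV \<and> (\<forall>c\<in>A. \<forall>d\<in>A. compatible c d) \<and>
     (\<forall>c. is_chart c \<and> (\<forall>d\<in>A. compatible c d) \<longrightarrow> c \<in> A)"

text \<open>A Riemannian metric is given by its component matrices \<open>G c\<close> in the charts \<open>c\<close>, subject to
  the transformation law of a covariant 2-tensor.\<close>

definition riemannian_metric ::
  "'a chart set \<Rightarrow> ('a chart \<Rightarrow> real^3 \<Rightarrow> real^3^3) \<Rightarrow> bool" where
  "riemannian_metric A G \<longleftrightarrow>
     (\<forall>c\<in>A. smooth_on (G c) (image_of c) \<and>
        (\<forall>x\<in>image_of c. transpose (G c x) = G c x \<and> (\<forall>v. v \<noteq> 0 \<longrightarrow> ip (G c x) v v > 0))) \<and>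
     (\<forall>c\<in>A. \<forall>d\<in>A. \<forall>p\<in>fst c \<inter> fst d.
        let J = (\<chi> a i. partial_on (snd c ` (fst c \<inter> fst d))
                            (\<lambda>z. transition c d z $ a) i (snd c p))
        in G c (snd c p) = transpose J ** G d (snd d p) ** J)"

definition riemannian_3_manifold ::
  "'a::{t2_space, second_countable_topology} chart set \<Rightarrow>
   ('a chart \<Rightarrow> real^3 \<Rightarrow> real^3^3) \<Rightarrow> bool" where
  "riemannian_3_manifold A G \<longleftrightarrow> smooth_structure A \<and> riemannian_metric A G"

definition manifold_boundary :: "'a chart set \<Rightarrow> 'a set" where
  "manifold_boundary A = {p. \<exists>c\<in>A. p \<in> fst c \<and> snd c p $ 3 = 0}"

definition velocity :: "'a chart \<Rightarrow> (real \<Rightarrow> 'a) \<Rightarrow> real set \<Rightarrow> real \<Rightarrow> real^3" where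
  "velocity c \<gamma> I t = vector_derivative (snd c \<circ> \<gamma>) (at t within I)"

definition geodesic ::
  "'a::topological_space chart set \<Rightarrow> ('a chart \<Rightarrow> real^3 \<Rightarrow> real^3^3) \<Rightarrow>
   (real \<Rightarrow> 'a) \<Rightarrow> real set \<Rightarrow> bool" where
  "geodesic A G \<gamma> I \<longleftrightarrow>
     continuous_on I \<gamma> \<and>
     (\<forall>c\<in>A. \<forall>t\<in>I. \<gamma> t \<in> fst c \<longrightarrow> geodesic_eq_at (image_of c) (G c) I (snd c \<circ> \<gamma>) t)"

text \<open>A chart \<open>c\<close> of \<open>M\<close> restricts to the chart \<open>bd_proj \<circ> snd c\<close> of \<open>\<partial>M\<close>, with inverse
  \<open>chart_inv c \<circ> bd\<close>; the induced metric is the pullback of \<open>G c\<close> under \<open>bd\<close>.\<close>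

definition bd :: "real^2 \<Rightarrow> real^3" where
  "bd x = vector [x $ 1, x $ 2, 0]"

definition bd_proj :: "real^3 \<Rightarrow> real^2" where
  "bd_proj v = vector [v $ 1, v $ 2]"

definition bd_image :: "'a chart \<Rightarrow> (real^2) set" where
  "bd_image c = {x. bd x \<in> image_of c}"

definition bd_metric :: "(real^3 \<Rightarrow> real^3^3) \<Rightarrow> real^2 \<Rightarrow> real^2^2" where
  "bd_metric g x = (\<chi> i j. ip (g (bd x)) (bd (axis i 1)) (bd (axis j 1)))"

definition boundary_geodesic ::
  "'a::topological_space chart set \<Rightarrow> ('a chart \<Rightarrow> real^3 \<Rightarrow> real^3^3) \<Rightarrow>
   (real \<Rightarrow> 'a) \<Rightarrow> real set \<Rightarrow> bool" where
  "boundary_geodesic A G \<gamma> I \<longleftrightarrow>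
     continuous_on I \<gamma> \<and> \<gamma> ` I \<subseteq> manifold_boundary A \<and>
     (\<forall>c\<in>A. \<forall>t\<in>I. \<gamma> t \<in> fst c \<longrightarrow>
        geodesic_eq_at (bd_image c) (bd_metric (G c)) I (bd_proj \<circ> snd c \<circ> \<gamma>) t)"

definition inward_unit_normal :: "real^3^3 \<Rightarrow> real^3 \<Rightarrow> bool" where
  "inward_unit_normal M n \<longleftrightarrow>
     (\<forall>w. w $ 3 = 0 \<longrightarrow> ip M n w = 0) \<and> ip M n n = 1 \<and> n $ 3 > 0"

text \<open>The chart \<open>c\<close> consists of Fermi coordinates at the boundary point \<open>q\<close>. Its image is required
  to contain, with each point, the coordinate segments along which that point is reached. The path
  in the normal direction is trivial when \<open>y = 0\<close>.\<close>

definition fermi_chart ::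
  "'a::topological_space chart set \<Rightarrow> ('a chart \<Rightarrow> real^3 \<Rightarrow> real^3^3) \<Rightarrow> 'a \<Rightarrow> 'a chart \<Rightarrow> bool" where
  "fermi_chart A G q c \<longleftrightarrow>
     c \<in> A \<and> q \<in> fst c \<and> snd c q = 0 \<and>
     (\<exists>e1 e2. e1 $ 3 = 0 \<and> e2 $ 3 = 0 \<and>
        ip (G c 0) e1 e1 = 1 \<and> ip (G c 0) e2 e2 = 1 \<and> ip (G c 0) e1 e2 = 0 \<and>
        (\<forall>x\<in>bd_image c.
           let \<gamma> = (\<lambda>t. chart_inv c (bd (t *\<^sub>R x))) in
             (\<forall>t\<in>{0..1}. t *\<^sub>R x \<in> bd_image c) \<and>
             boundary_geodesic A G \<gamma> {0..1} \<and>
             velocity c \<gamma> {0..1} 0 = x $ 1 *\<^sub>R e1 + x $ 2 *\<^sub>R e2)) \<and>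
     (\<forall>v\<in>image_of c. v $ 3 > 0 \<longrightarrow>
        (let \<gamma> = (\<lambda>t. chart_inv c (vector [v $ 1, v $ 2, t])) in
           (\<forall>t\<in>{0..v $ 3}. vector [v $ 1, v $ 2, t] \<in> image_of c) \<and>
           geodesic A G \<gamma> {0..v $ 3} \<and>
           inward_unit_normal (G c (snd c (\<gamma> 0))) (velocity c \<gamma> {0..v $ 3} 0)))"

definition fermi_hemisphere :: "'a chart \<Rightarrow> real \<Rightarrow> 'a set" where
  "fermi_hemisphere c r =
     {p \<in> fst c. (snd c p $ 1)\<^sup>2 + (snd c p $ 2)\<^sup>2 + (snd c p $ 3)\<^sup>2 = r\<^sup>2}"

text \<open>Throughout, \<open>S\<close> is a coordinate domain with metric \<open>g\<close>, and \<open>X\<close> a parametrization, defined on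
  the open set \<open>D\<close> of \<open>\<real>\<^sup>2\<close>, of a surface in \<open>S\<close>.\<close>

definition first_form ::
  "(real^3 \<Rightarrow> real^3^3) \<Rightarrow> (real^2) set \<Rightarrow> (real^2 \<Rightarrow> real^3) \<Rightarrow> real^2 \<Rightarrow> real^2^2" where
  "first_form g D X u = (\<chi> i j. ip (g (X u)) (partial_on D X i u) (partial_on D X j u))"

text \<open>The covariant derivative \<open>\<nabla>\<^bsub>\<partial>\<^sub>i\<^esub> \<partial>\<^sub>j\<close> of the coordinate fields of the surface.\<close>

definition cov_deriv ::
  "(real^3) set \<Rightarrow> (real^3 \<Rightarrow> real^3^3) \<Rightarrow> (real^2) set \<Rightarrow> (real^2 \<Rightarrow> real^3) \<Rightarrow>
   2 \<Rightarrow> 2 \<Rightarrow> real^2 \<Rightarrow> real^3" where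
  "cov_deriv S g D X i j u =
     partial_on D (partial_on D X j) i u +
     (\<chi> k. \<Sum>a\<in>UNIV. \<Sum>b\<in>UNIV.
        christoffel S g k a b (X u) * partial_on D X i u $ a * partial_on D X j u $ b)"

definition second_form ::
  "(real^3) set \<Rightarrow> (real^3 \<Rightarrow> real^3^3) \<Rightarrow> (real^2) set \<Rightarrow> (real^2 \<Rightarrow> real^3) \<Rightarrow> real^3 \<Rightarrow>
   real^2 \<Rightarrow> real^2^2" where
  "second_form S g D X n u = (\<chi> i j. ip (g (X u)) (cov_deriv S g D X i j u) n)"

definition mean_curvature ::
  "(real^3) set \<Rightarrow> (real^3 \<Rightarrow> real^3^3) \<Rightarrow> (real^2) set \<Rightarrow> (real^2 \<Rightarrow> real^3) \<Rightarrow> real^3 \<Rightarrow>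
   real^2 \<Rightarrow> real" where
  "mean_curvature S g D X n u =
     trace (matrix_inv (first_form g D X u) ** second_form S g D X n u)"

definition boundary_mean_curvature ::
  "('a chart \<Rightarrow> real^3 \<Rightarrow> real^3^3) \<Rightarrow> 'a chart \<Rightarrow> 'a \<Rightarrow> real" where
  "boundary_mean_curvature G c q =
     mean_curvature (image_of c) (G c) (bd_image c) bd
       (THE n. inward_unit_normal (G c (snd c q)) n) (bd_proj (snd c q))"

definition unit_normal ::
  "(real^3 \<Rightarrow> real^3^3) \<Rightarrow> (real^2) set \<Rightarrow> (real^2 \<Rightarrow> real^3) \<Rightarrow> real^2 \<Rightarrow> real^3 \<Rightarrow> bool" where
  "unit_normal g D X u n \<longleftrightarrow>
     (\<forall>i. ip (g (X u)) n (partial_on D X i u) = 0) \<and> ip (g (X u)) n n = 1"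

text \<open>\<open>X\<close> is an injective immersion of \<open>D\<close> into the surface \<open>\<Sigma>\<close>, onto up to finitely many
  \<open>C\<^sup>1\<close> arcs (which have zero area).\<close>

definition parametrizes :: "(real^2) set \<Rightarrow> (real^2 \<Rightarrow> real^3) \<Rightarrow> (real^3) set \<Rightarrow> bool" where
  "parametrizes D X \<Sigma> \<longleftrightarrow>
     open D \<and> smooth_on X D \<and> inj_on X D \<and> (\<forall>u\<in>D. inj (frechet_derivative X (at u))) \<and>
     X ` D \<subseteq> \<Sigma> \<and>
     (\<exists>P. finite P \<and> (\<forall>p\<in>P. p C1_differentiable_on {0..1}) \<and>
          \<Sigma> - X ` D \<subseteq> (\<Union>p\<in>P. p ` {0..1}))"

text \<open>\<open>W\<close> is the integral over the surface \<open>\<Sigma>\<close>, contained in the domain of \<open>c\<close>, of the squared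
  mean curvature with respect to the area measure, computed in a parametrization. By
  reparametrization invariance \<open>W\<close> depends neither on the parametrization nor, because of the
  square, on the unit normal field \<open>n\<close>.\<close>

definition has_willmore_integral ::
  "('a chart \<Rightarrow> real^3 \<Rightarrow> real^3^3) \<Rightarrow> 'a chart \<Rightarrow> 'a set \<Rightarrow> real \<Rightarrow> bool" where
  "has_willmore_integral G c \<Sigma> W \<longleftrightarrow>
     \<Sigma> \<subseteq> fst c \<and>
     (\<exists>D X n. parametrizes D X (snd c ` \<Sigma>) \<and>
        (\<forall>u\<in>D. unit_normal (G c) D X u (n u)) \<and>
        ((\<lambda>u. (mean_curvature (image_of c) (G c) D X (n u) u)\<^sup>2 * sqrt (det (first_form (G c) D X u)))
           has_integral W) D)"

end

theory Submission
  imports Defs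
begin

text \<open>Only the first-order Taylor polynomial of the metric at \<open>q\<close> matters: in Fermi coordinates it is
  \<open>g = I + y A\<close> with \<open>A\<close> tangential, because radial boundary geodesics kill the tangential derivatives
  and the normal geodesic kills \<open>\<partial>\<^sub>y g\<^sub>3\<^sub>l\<close>; moreover \<open>H\<^sub>0 = - tr A / 2\<close>. The hemisphere is
  \<open>r \<omega>\<close> with \<open>\<omega>\<close> in the unit half-sphere, and since \<open>\<omega>\<close> is also its Euclidean conormal, the mean
  curvature and the area density are rational expressions (up to one square root) in the entries of
  \<open>g\<close> and \<open>r \<omega>\<^sub>k \<Gamma>\<^sup>k\<close>. Relative to the round area measure,
  \<open>H\<^sup>2 d\<sigma> = 4 + 8 r y A(\<omega>, \<omega>) + O(r\<^sup>2)\<close> uniformly in \<open>\<omega>\<close>, and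
  integrating \<open>y \<omega>\<^sub>i \<omega>\<^sub>j\<close> over the half-sphere gives \<open>8 \<pi> + 2 \<pi> r tr A\<close>.\<close>

section \<open>Uniform first-order expansions\<close>

text \<open>On a half-space, derivatives at y = 0 are one-sided and smoothness only means local
  extendability. All analysis is therefore done on a smooth extension \<open>F\<close> of the
  components to a full neighbourhood of 0; the half-space returns only when the integrand is
  identified. The spherical coordinates degenerate at the pole, which threatens uniformity. The way
  around is that H is a mixed Gram determinant divided by a pure one, and both depend on the tangent
  vectors only through their cross product. The density is thus a function of the point of the
  sphere alone, and the degenerate factor sin splits off exactly. The powers of r also split off
  exactly: II carries 1/r, the area r^2, and H^2 times the area density has a limit. In what is left
  the Christoffel symbols carry a factor r, so only their values at 0 matter, while the metric
  itself is needed to first order.\<close>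

definition expn :: "'u set \<Rightarrow> (real \<Rightarrow> 'u \<Rightarrow> real) \<Rightarrow> ('u \<Rightarrow> real) \<Rightarrow> ('u \<Rightarrow> real) \<Rightarrow> bool" where
  "expn K f a b \<longleftrightarrow> (\<exists>C. (\<forall>u\<in>K. \<bar>a u\<bar> \<le> C \<and> \<bar>b u\<bar> \<le> C) \<and>
     (\<forall>\<^sub>F r in at_right 0. \<forall>u\<in>K. \<bar>f r u - (a u + r * b u)\<bar> \<le> C * r\<^sup>2))"

lemma expnI:
  assumes "\<And>u. u \<in> K \<Longrightarrow> \<bar>a u\<bar> \<le> Ca" "\<And>u. u \<in> K \<Longrightarrow> \<bar>b u\<bar> \<le> Cb"
    "\<forall>\<^sub>F r in at_right 0. \<forall>u\<in>K. \<bar>f r u - (a u + r * b u)\<bar> \<le> C * r\<^sup>2"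
  shows "expn K f a b"
  unfolding expn_def
proof (intro exI[of _ "max (max Ca Cb) C"] conjI ballI)
  show "\<forall>\<^sub>F r in at_right 0. \<forall>u\<in>K. \<bar>f r u - (a u + r * b u)\<bar> \<le> max (max Ca Cb) C * r\<^sup>2"
    using assms(3)
  proof eventually_elim
    case (elim r)
    have "C * r\<^sup>2 \<le> max (max Ca Cb) C * r\<^sup>2" by (intro mult_right_mono) auto
    with elim show ?case by force
  qed
qed (use assms(1,2) in \<open>auto simp: le_max_iff_disj\<close>)

lemma expnE:
  assumes "expn K f a b"
  obtains C where "C > 0" "\<And>u. u \<in> K \<Longrightarrow> \<bar>a u\<bar> \<le> C" "\<And>u. u \<in> K \<Longrightarrow> \<bar>b u\<bar> \<le> C"
    "\<forall>\<^sub>F r in at_right 0. \<forall>u\<in>K. \<bar>f r u - (a u + r * b u)\<bar> \<le> C * r\<^sup>2"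
proof -
  from assms obtain C where C: "\<forall>u\<in>K. \<bar>a u\<bar> \<le> C \<and> \<bar>b u\<bar> \<le> C"
    "\<forall>\<^sub>F r in at_right 0. \<forall>u\<in>K. \<bar>f r u - (a u + r * b u)\<bar> \<le> C * r\<^sup>2"
    by (auto simp: expn_def)
  show ?thesis
  proof (rule that[of "\<bar>C\<bar> + 1"])
    show "\<forall>\<^sub>F r in at_right 0. \<forall>u\<in>K. \<bar>f r u - (a u + r * b u)\<bar> \<le> (\<bar>C\<bar> + 1) * r\<^sup>2"
      using C(2)
    proof eventually_elim
      case (elim r)
      have "C * r\<^sup>2 \<le> (\<bar>C\<bar> + 1) * r\<^sup>2" by (intro mult_right_mono) auto
      with elim show ?case by force
    qed
  qed (use C(1) in \<open>auto intro: order_trans[of _ C]\<close>)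
qed

lemma eventually_at_right_0_less: "x > 0 \<Longrightarrow> \<forall>\<^sub>F r in at_right (0::real). 0 < r \<and> r < x"
  using eventually_at_right_real[of 0 x] by (auto elim!: eventually_mono)

lemma expn_cong:
  assumes "expn K f a b" "\<And>u. u \<in> K \<Longrightarrow> a u = a' u" "\<And>u. u \<in> K \<Longrightarrow> b u = b' u"
    "\<And>r u. r > 0 \<Longrightarrow> u \<in> K \<Longrightarrow> f r u = f' r u"
  shows "expn K f' a' b'"
proof -
  from expnE[OF assms(1)] obtain C where C: "C > 0" "\<And>u. u \<in> K \<Longrightarrow> \<bar>a u\<bar> \<le> C" "\<And>u. u \<in> K \<Longrightarrow> \<bar>b u\<bar> \<le> C"
    "\<forall>\<^sub>F r in at_right 0. \<forall>u\<in>K. \<bar>f r u - (a u + r * b u)\<bar> \<le> C * r\<^sup>2" by blast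
  show ?thesis
  proof (rule expnI[where Ca=C and Cb=C])
    show "\<forall>\<^sub>F r in at_right 0. \<forall>u\<in>K. \<bar>f' r u - (a' u + r * b' u)\<bar> \<le> C * r\<^sup>2"
      using C(4) eventually_at_right_less[of 0] by eventually_elim (simp add: assms)
  qed (use C(2,3) assms(2,3) in auto)
qed

lemma expn_eq:
  assumes "expn K f a b" "\<And>u. u \<in> K \<Longrightarrow> a u = a' u" "\<And>u. u \<in> K \<Longrightarrow> b u = b' u"
  shows "expn K f a' b'"
  using expn_cong[OF assms] by simp

lemma expn_0th:
  assumes "\<And>u. u \<in> K \<Longrightarrow> \<bar>a u\<bar> \<le> C"
  shows "expn K (\<lambda>r u. a u) a (\<lambda>u. 0)"
  by (rule expnI[where C=0, OF assms]) auto

lemma expn_const: "expn K (\<lambda>r u. c) (\<lambda>u. c) (\<lambda>u. 0)"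
  by (rule expn_0th[where C="\<bar>c\<bar>"]) auto

lemma expn_r: "expn K (\<lambda>r u. r) (\<lambda>u. 0) (\<lambda>u. 1)"
  by (rule expnI[where C=0]) auto

lemma expn_add:
  assumes "expn K f a b" "expn K f' a' b'"
  shows "expn K (\<lambda>r u. f r u + f' r u) (\<lambda>u. a u + a' u) (\<lambda>u. b u + b' u)"
proof -
  from expnE[OF assms(1)] obtain C where C: "C > 0" "\<And>u. u \<in> K \<Longrightarrow> \<bar>a u\<bar> \<le> C" "\<And>u. u \<in> K \<Longrightarrow> \<bar>b u\<bar> \<le> C"
    "\<forall>\<^sub>F r in at_right 0. \<forall>u\<in>K. \<bar>f r u - (a u + r * b u)\<bar> \<le> C * r\<^sup>2" by blast
  from expnE[OF assms(2)] obtain C' where C': "C' > 0" "\<And>u. u \<in> K \<Longrightarrow> \<bar>a' u\<bar> \<le> C'" "\<And>u. u \<in> K \<Longrightarrow> \<bar>b' u\<bar> \<le> C'"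
    "\<forall>\<^sub>F r in at_right 0. \<forall>u\<in>K. \<bar>f' r u - (a' u + r * b' u)\<bar> \<le> C' * r\<^sup>2" by blast
  show ?thesis
  proof (rule expnI[where Ca="C+C'" and Cb="C+C'" and C="C+C'"])
    show "\<forall>\<^sub>F r in at_right 0. \<forall>u\<in>K. \<bar>f r u + f' r u - (a u + a' u + r * (b u + b' u))\<bar> \<le> (C+C') * r\<^sup>2"
      using C(4) C'(4)
    proof eventually_elim
      case (elim r)
      show ?case
      proof
        fix u assume u: "u \<in> K"
        have "f r u + f' r u - (a u + a' u + r * (b u + b' u))
            = (f r u - (a u + r * b u)) + (f' r u - (a' u + r * b' u))" by (simp add: algebra_simps)
        also have "\<bar>\<dots>\<bar> \<le> C * r\<^sup>2 + C' * r\<^sup>2" using elim u by (intro abs_triangle_ineq[THEN order_trans] add_mono) auto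
        finally show "\<bar>f r u + f' r u - (a u + a' u + r * (b u + b' u))\<bar> \<le> (C+C') * r\<^sup>2"
          by (simp add: algebra_simps)
      qed
    qed
  qed (auto intro!: abs_triangle_ineq[THEN order_trans] add_mono C C')
qed

text \<open>The coefficient bounds built into \<open>expn\<close> are needed here: each error is
  multiplied by the other factor, and the dropped term r^2 b b' must itself be uniformly
  O(r^2).\<close>

lemma expn_mult:
  assumes "expn K f a b" "expn K f' a' b'"
  shows "expn K (\<lambda>r u. f r u * f' r u) (\<lambda>u. a u * a' u) (\<lambda>u. a u * b' u + b u * a' u)"
proof -
  from expnE[OF assms(1)] obtain C where C: "C > 0" "\<And>u. u \<in> K \<Longrightarrow> \<bar>a u\<bar> \<le> C" "\<And>u. u \<in> K \<Longrightarrow> \<bar>b u\<bar> \<le> C"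
    "\<forall>\<^sub>F r in at_right 0. \<forall>u\<in>K. \<bar>f r u - (a u + r * b u)\<bar> \<le> C * r\<^sup>2" by blast
  from expnE[OF assms(2)] obtain C' where C': "C' > 0" "\<And>u. u \<in> K \<Longrightarrow> \<bar>a' u\<bar> \<le> C'" "\<And>u. u \<in> K \<Longrightarrow> \<bar>b' u\<bar> \<le> C'"
    "\<forall>\<^sub>F r in at_right 0. \<forall>u\<in>K. \<bar>f' r u - (a' u + r * b' u)\<bar> \<le> C' * r\<^sup>2" by blast
  show ?thesis
  \<comment> \<open>6 = 3 + 2 + 1: for r < 1 the second factor is at most 3 C', the linear part of
    the first at most 2 C, and r^2 b b' contributes C C'.\<close>
  proof (rule expnI[where Ca="C*C'" and Cb="2*C*C'" and C="6*C*C'"])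
    show "\<forall>\<^sub>F r in at_right 0. \<forall>u\<in>K. \<bar>f r u * f' r u - (a u * a' u + r * (a u * b' u + b u * a' u))\<bar> \<le> (6*C*C') * r\<^sup>2"
      using C(4) C'(4) eventually_at_right_0_less[of 1, simplified]
    proof eventually_elim
      case (elim r)
      show ?case
      proof
        fix u assume u: "u \<in> K"
        define p where "p = f r u - (a u + r * b u)"
        define p' where "p' = f' r u - (a' u + r * b' u)"
        have r: "0 < r" "r < 1" "r\<^sup>2 \<le> 1" using elim by (auto simp: power_le_one)
        have p: "\<bar>p\<bar> \<le> C * r\<^sup>2" "\<bar>p'\<bar> \<le> C' * r\<^sup>2" using elim u by (auto simp: p_def p'_def)
        have "C' * r\<^sup>2 \<le> C' * 1" using r C'(1) by (intro mult_left_mono) auto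
        then have p1: "\<bar>p'\<bar> \<le> C'" using p by linarith
        have rb: "\<bar>r * b u\<bar> \<le> C" "\<bar>r * b' u\<bar> \<le> C'"
          using r C(3)[OF u] C'(3)[OF u] mult_mono[of r 1 "\<bar>b u\<bar>" C] mult_mono[of r 1 "\<bar>b' u\<bar>" C']
          by (auto simp: abs_mult)
        have m: "\<bar>p * (a' u + r * b' u + p')\<bar> \<le> (C * r\<^sup>2) * (3 * C')"
          unfolding abs_mult using p p1 rb C'(2)[OF u] C(1) by (intro mult_mono) simp_all
        have m2: "\<bar>(a u + r * b u) * p'\<bar> \<le> (2 * C) * (C' * r\<^sup>2)"
          unfolding abs_mult using p(2) rb(1) C(2)[OF u] C(1) by (intro mult_mono) simp_all
        have m3: "\<bar>r\<^sup>2 * (b u * b' u)\<bar> \<le> r\<^sup>2 * (C * C')"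
          unfolding abs_mult using C(3)[OF u] C'(3)[OF u] C(1) by (intro mult_mono) simp_all
        have "f r u * f' r u - (a u * a' u + r * (a u * b' u + b u * a' u))
           = p * (a' u + r * b' u + p') + (a u + r * b u) * p' + r\<^sup>2 * (b u * b' u)"
          by (simp add: p_def p'_def algebra_simps power2_eq_square)
        then have "\<bar>f r u * f' r u - (a u * a' u + r * (a u * b' u + b u * a' u))\<bar>
          \<le> (C * r\<^sup>2) * (3 * C') + (2 * C) * (C' * r\<^sup>2) + r\<^sup>2 * (C * C')"
          using m m2 m3 by linarith
        then show "\<bar>f r u * f' r u - (a u * a' u + r * (a u * b' u + b u * a' u))\<bar> \<le> 6*C*C' * r\<^sup>2"
          by (simp add: algebra_simps)
      qed
    qed
    show "\<bar>a u * a' u\<bar> \<le> C * C'" if "u \<in> K" for u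
      unfolding abs_mult using C(1) C(2)[OF that] C'(2)[OF that] by (intro mult_mono) simp_all
    show "\<bar>a u * b' u + b u * a' u\<bar> \<le> 2 * C * C'" if "u \<in> K" for u
    proof -
      have "\<bar>a u * b' u\<bar> \<le> C * C'" "\<bar>b u * a' u\<bar> \<le> C * C'"
        unfolding abs_mult using C(1) C(2,3)[OF that] C'(2,3)[OF that] by (intro mult_mono; simp)+
      then show ?thesis by linarith
    qed
  qed
qed

lemma expn_cmult:
  assumes "expn K f a b" shows "expn K (\<lambda>r u. c * f r u) (\<lambda>u. c * a u) (\<lambda>u. c * b u)"
  by (rule expn_cong[OF expn_mult[OF expn_const assms]]) auto

lemma expn_diff:
  assumes "expn K f a b" "expn K f' a' b'"
  shows "expn K (\<lambda>r u. f r u - f' r u) (\<lambda>u. a u - a' u) (\<lambda>u. b u - b' u)"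
  by (rule expn_cong[OF expn_add[OF assms(1) expn_cmult[OF assms(2), of "-1"]]]) auto

lemma expn_near:
  assumes "expn K f (\<lambda>u. a) b" "e > 0"
  shows "\<forall>\<^sub>F r in at_right 0. \<forall>u\<in>K. \<bar>f r u - a\<bar> < e"
proof -
  from expnE[OF assms(1)] obtain C where C: "C > 0" "\<And>u. u \<in> K \<Longrightarrow> \<bar>a\<bar> \<le> C" "\<And>u. u \<in> K \<Longrightarrow> \<bar>b u\<bar> \<le> C"
    "\<forall>\<^sub>F r in at_right 0. \<forall>u\<in>K. \<bar>f r u - (a + r * b u)\<bar> \<le> C * r\<^sup>2" by blast
  \<comment> \<open>For r < 1 the deviation from \<open>a\<close> is at most C r + C r^2 \<le> 2 C
    r.\<close>
  have "0 < min 1 (e / (2 * C))" using C(1) assms(2) by auto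
  from C(4) eventually_at_right_0_less[OF this] show ?thesis
  proof eventually_elim
    case (elim r)
    show ?case
    proof
      fix u assume u: "u \<in> K"
      have r: "0 < r" "r < 1" "r * (2 * C) < e" using elim C(1) by (auto simp: field_simps)
      have "\<bar>f r u - (a + r * b u)\<bar> \<le> C * r\<^sup>2" using elim u by auto
      moreover have "C * r\<^sup>2 \<le> C * r" using r C(1) by (simp add: power2_eq_square)
      moreover have "\<bar>r * b u\<bar> \<le> r * C" using r C(3)[OF u] by (simp add: abs_mult)
      ultimately show "\<bar>f r u - a\<bar> < e" using r(3) by (simp add: algebra_simps abs_if split: if_splits)
    qed
  qed
qed

text \<open>Since f - 1 is uniformly O(r), a quadratic Taylor remainder at 1 becomes O(r^2), and f
  eventually stays where the Taylor bound is valid. Every quantity to be inverted or rooted is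
  arranged to start at 1.\<close>

lemma expn_compose:
  assumes f: "expn K f (\<lambda>u. 1) b"
    and \<phi>: "\<And>x. \<bar>x - 1\<bar> < 1/2 \<Longrightarrow> \<bar>\<phi> x - (1 + d * (x - 1))\<bar> \<le> M * (x - 1)\<^sup>2"
  shows "expn K (\<lambda>r u. \<phi> (f r u)) (\<lambda>u. 1) (\<lambda>u. d * b u)"
proof -
  obtain C where C: "C > 0" "\<And>u. u \<in> K \<Longrightarrow> \<bar>b u\<bar> \<le> C"
    "\<forall>\<^sub>F r in at_right 0. \<forall>u\<in>K. \<bar>f r u - (1 + r * b u)\<bar> \<le> C * r\<^sup>2"
    by (rule expnE[OF f]) (rule that)
  show ?thesis
  \<comment> \<open>The first summand comes from squaring |f - 1| \<le> 2 C r, the second is the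
    error of f multiplied by the slope d.\<close>
  proof (rule expnI[where Ca=1 and Cb="\<bar>d\<bar> * C" and C="\<bar>M\<bar> * (2 * C)\<^sup>2 + \<bar>d\<bar> * C"])
    show "\<forall>\<^sub>F r in at_right 0. \<forall>u\<in>K. \<bar>\<phi> (f r u) - (1 + r * (d * b u))\<bar>
        \<le> (\<bar>M\<bar> * (2 * C)\<^sup>2 + \<bar>d\<bar> * C) * r\<^sup>2"
      using C(3) eventually_at_right_0_less[of 1, simplified] expn_near[OF f, of "1/2", simplified]
    proof eventually_elim
      case (elim r)
      show ?case
      proof
        fix u assume u: "u \<in> K"
        define x where "x = f r u"
        have r: "0 < r" "r < 1" using elim by auto
        have x: "\<bar>x - 1\<bar> < 1/2" "\<bar>x - (1 + r * b u)\<bar> \<le> C * r\<^sup>2" using elim u by (auto simp: x_def)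
        have "C * r\<^sup>2 \<le> C * r" using r C(1) by (simp add: power2_eq_square)
        moreover have "\<bar>r * b u\<bar> \<le> r * C" using r C(2)[OF u] by (simp add: abs_mult)
        ultimately have "\<bar>x - 1\<bar> \<le> \<bar>2 * C * r\<bar>" using x(2) by (simp add: algebra_simps abs_if split: if_splits)
        then have "(x - 1)\<^sup>2 \<le> (2 * C * r)\<^sup>2" by (simp only: abs_le_square_iff)
        then have "(x - 1)\<^sup>2 \<le> (2 * C)\<^sup>2 * r\<^sup>2" by (simp add: power_mult_distrib)
        then have "M * (x - 1)\<^sup>2 \<le> \<bar>M\<bar> * ((2 * C)\<^sup>2 * r\<^sup>2)" by (intro mult_mono) auto
        then have 1: "\<bar>\<phi> x - (1 + d * (x - 1))\<bar> \<le> \<bar>M\<bar> * (2 * C)\<^sup>2 * r\<^sup>2"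
          using \<phi>[OF x(1)] by (simp add: mult.assoc)
        have 2: "\<bar>d * (x - (1 + r * b u))\<bar> \<le> \<bar>d\<bar> * (C * r\<^sup>2)"
          unfolding abs_mult using x(2) by (intro mult_left_mono) auto
        have "\<phi> x - (1 + r * (d * b u)) = (\<phi> x - (1 + d * (x - 1))) + d * (x - (1 + r * b u))"
          by (simp add: algebra_simps)
        then show "\<bar>\<phi> (f r u) - (1 + r * (d * b u))\<bar> \<le> (\<bar>M\<bar> * (2 * C)\<^sup>2 + \<bar>d\<bar> * C) * r\<^sup>2"
          using 1 2 unfolding x_def[symmetric] by (simp add: algebra_simps)
      qed
    qed
    show "\<bar>d * b u\<bar> \<le> \<bar>d\<bar> * C" if "u \<in> K" for u
      unfolding abs_mult using C(2)[OF that] by (intro mult_left_mono) auto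
  qed auto
qed

lemma expn_inverse:
  assumes "expn K f (\<lambda>u. 1) b"
  shows "expn K (\<lambda>r u. inverse (f r u)) (\<lambda>u. 1) (\<lambda>u. - b u)"
proof -
  have "\<bar>inverse x - (1 + -1 * (x - 1))\<bar> \<le> 2 * (x - 1)\<^sup>2" if "\<bar>x - 1\<bar> < 1/2" for x :: real
  proof -
    have x: "x > 1/2" using that by (simp add: abs_if split: if_splits)
    have "inverse x - (1 + -1 * (x - 1)) = (x - 1)\<^sup>2 * inverse x"
      using x by (simp add: field_simps power2_eq_square)
    moreover have "(x - 1)\<^sup>2 * inverse x \<le> (x - 1)\<^sup>2 * 2"
      using x by (intro mult_left_mono) (auto simp: field_simps)
    moreover have "(x - 1)\<^sup>2 * inverse x \<ge> 0" using x by auto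
    ultimately show ?thesis by simp
  qed
  from expn_compose[OF assms this] show ?thesis by simp
qed

lemma expn_sqrt:
  assumes "expn K f (\<lambda>u. 1) b"
  shows "expn K (\<lambda>r u. sqrt (f r u)) (\<lambda>u. 1) (\<lambda>u. b u / 2)"
proof -
  have "\<bar>sqrt x - (1 + 1/2 * (x - 1))\<bar> \<le> 1 * (x - 1)\<^sup>2" if "\<bar>x - 1\<bar> < 1/2" for x :: real
  proof -
    define s where "s = sqrt x"
    have x: "x > 1/2" using that by (simp add: abs_if split: if_splits)
    have s: "s > 0" "x = s\<^sup>2" using x by (auto simp: s_def)
    \<comment> \<open>x - 1 = (s + 1)(s - 1) with s + 1 \<ge> 1, so the remainder -(s - 1)^2 / 2 is
      controlled by (x - 1)^2.\<close>
    have "1 * (s - 1)\<^sup>2 \<le> (s + 1)\<^sup>2 * (s - 1)\<^sup>2"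
      using s by (intro mult_right_mono) (auto intro: one_le_power)
    then have "(s - 1)\<^sup>2 \<le> (x - 1)\<^sup>2" by (simp add: s power2_eq_square algebra_simps)
    moreover have "s - (1 + 1/2 * (x - 1)) = - (s - 1)\<^sup>2 / 2"
      by (simp add: s power2_eq_square field_simps)
    moreover have "(s - 1)\<^sup>2 \<ge> 0" by simp
    ultimately show ?thesis unfolding s_def[symmetric] by linarith
  qed
  from expn_compose[OF assms this] show ?thesis by simp
qed

section \<open>Taylor bounds for maps of class \<open>Ck_on\<close>\<close>

lemma Ck_on_imp_continuous_on: "Ck_on k f S \<Longrightarrow> continuous_on S f"
  by (cases k) (auto intro: differentiable_imp_continuous_on)

lemma Ck_on_Suc_D:
  assumes "Ck_on (Suc k) f S" "open S" "x \<in> S"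
  shows "(f has_derivative frechet_derivative f (at x)) (at x)"
proof -
  have "f differentiable (at x within S)" using assms by (auto simp: differentiable_on_def)
  then have "f differentiable (at x)" using assms at_within_open by metis
  then show ?thesis using frechet_derivative_works by blast
qed

text \<open>\<open>Ck_on\<close> gives continuity of the derivative only in each fixed direction.
  Compactness bounds it in the finitely many basis directions, and the sum of these bounds dominates
  the operator norm.\<close>

lemma Ck_on_bounded_derivative:
  fixes f :: "'a::euclidean_space \<Rightarrow> 'b::real_normed_vector"
  assumes f: "Ck_on 1 f V" "open V" and K: "compact K" "K \<subseteq> V"
  obtains B where "B \<ge> 0" "\<And>x. x \<in> K \<Longrightarrow> onorm (frechet_derivative f (at x)) \<le> B"
proof -
  have bdd: "\<exists>B. \<forall>x\<in>K. norm (frechet_derivative f (at x) b) \<le> B" for b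
  proof -
    have "continuous_on K (\<lambda>x. frechet_derivative f (at x) b)"
      using f K by (auto intro: continuous_on_subset)
    then have "bounded ((\<lambda>x. frechet_derivative f (at x) b) ` K)"
      using K(1) compact_continuous_image compact_imp_bounded by blast
    then show ?thesis by (auto simp: bounded_iff)
  qed
  then obtain B where B: "\<And>b x. x \<in> K \<Longrightarrow> norm (frechet_derivative f (at x) b) \<le> B b" by metis
  show ?thesis
  proof (rule that[of "\<Sum>b\<in>Basis. \<bar>B b\<bar>"])
    fix x assume x: "x \<in> K"
    have d: "linear (frechet_derivative f (at x))"
      using Ck_on_Suc_D[of 0 f V x] f K x has_derivative_linear by auto
    show "onorm (frechet_derivative f (at x)) \<le> (\<Sum>b\<in>Basis. \<bar>B b\<bar>)"
    proof (rule onorm_bound)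
      fix v :: 'a
      have "norm (frechet_derivative f (at x) v) = norm (\<Sum>b\<in>Basis. (v \<bullet> b) *\<^sub>R frechet_derivative f (at x) b)"
        by (subst (1) euclidean_representation[of v, symmetric]) (simp add: linear_sum[OF d] linear_cmul[OF d])
      also have "\<dots> \<le> (\<Sum>b\<in>Basis. norm ((v \<bullet> b) *\<^sub>R frechet_derivative f (at x) b))"
        by (rule norm_sum)
      also have "\<dots> \<le> (\<Sum>b\<in>Basis. norm v * \<bar>B b\<bar>)"
      proof (rule sum_mono)
        fix b :: 'a assume b: "b \<in> Basis"
        have "\<bar>v \<bullet> b\<bar> * norm (frechet_derivative f (at x) b) \<le> norm v * \<bar>B b\<bar>"
          using B[OF x, of b] Basis_le_norm[OF b, of v] by (intro mult_mono) auto
        then show "norm ((v \<bullet> b) *\<^sub>R frechet_derivative f (at x) b) \<le> norm v * \<bar>B b\<bar>" by simp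
      qed
      also have "\<dots> = (\<Sum>b\<in>Basis. \<bar>B b\<bar>) * norm v" by (simp add: sum_distrib_left mult.commute)
      finally show "norm (frechet_derivative f (at x) v) \<le> (\<Sum>b\<in>Basis. \<bar>B b\<bar>) * norm v" .
    qed (simp add: sum_nonneg)
  qed (simp add: sum_nonneg)
qed

text \<open>Mean value inequality on a ball; in \<open>Ck_on_Taylor\<close> it is applied to the
  directional derivatives of a twice differentiable map.\<close>

lemma Ck_on_derivative_Lipschitz:
  fixes f :: "'a::euclidean_space \<Rightarrow> 'b::real_normed_vector"
  assumes f: "Ck_on 1 f V" "open V" "cball 0 \<epsilon> \<subseteq> V" and e: "\<epsilon> \<ge> 0"
  obtains L where "L \<ge> 0" "\<And>x. norm x \<le> \<epsilon> \<Longrightarrow> norm (f x - f 0) \<le> L * norm x"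
proof -
  obtain B where B: "B \<ge> 0"
    "\<And>x. x \<in> cball 0 \<epsilon> \<Longrightarrow> onorm (frechet_derivative f (at x)) \<le> B"
    by (rule Ck_on_bounded_derivative[OF f(1,2) compact_cball f(3)]) (rule that)
  have D: "(f has_derivative frechet_derivative f (at x)) (at x within cball 0 \<epsilon>)" if "norm x \<le> \<epsilon>" for x
  proof (rule has_derivative_at_withinI[OF Ck_on_Suc_D])
    show "Ck_on (Suc 0) f V" using f(1) by simp
    show "x \<in> V" using f(3) that by auto
  qed fact
  show ?thesis
  proof (rule that[OF B(1)])
    fix x :: 'a assume x: "norm x \<le> \<epsilon>"
    show "norm (f x - f 0) \<le> B * norm x"
      using differentiable_bound[of "cball 0 \<epsilon>" f "\<lambda>x. frechet_derivative f (at x)" B x 0] B(2) x e D by simp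
  qed
qed

text \<open>Subtracting the differential at 0 leaves a map whose derivative on the ball of radius
  |x| is O(|x|); the mean value inequality on that ball supplies the second factor |x|.\<close>

lemma Ck_on_Taylor:
  fixes f :: "'a::euclidean_space \<Rightarrow> 'b::real_normed_vector"
  assumes f: "Ck_on 2 f V" "open V" "cball 0 \<epsilon> \<subseteq> V" and e: "\<epsilon> \<ge> 0"
  obtains L where "\<And>x. norm x \<le> \<epsilon> \<Longrightarrow>
     norm (f x - (f 0 + frechet_derivative f (at 0) x)) \<le> L * (norm x)\<^sup>2"
proof -
  let ?D = "\<lambda>x. frechet_derivative f (at x)"
  have f2: "Ck_on (Suc (Suc 0)) f V" using f(1) by (simp only: numeral_2_eq_2)
  have "\<exists>L\<ge>0. \<forall>x. norm x \<le> \<epsilon> \<longrightarrow> norm (?D x b - ?D 0 b) \<le> L * norm x" for b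
  proof -
    have "Ck_on 1 (\<lambda>x. ?D x b) V" using f2 by simp
    from Ck_on_derivative_Lipschitz[OF this f(2,3) e] show ?thesis by metis
  qed
  then obtain L where L: "\<And>b. L b \<ge> 0"
    "\<And>b x. norm x \<le> \<epsilon> \<Longrightarrow> norm (?D x b - ?D 0 b) \<le> L b * norm x" by metis
  have D: "(f has_derivative ?D x) (at x)" if "norm x \<le> \<epsilon>" for x
    using Ck_on_Suc_D[OF f2 f(2), of x] that f(3) by auto
  have lin: "linear (\<lambda>v. ?D x v - ?D 0 v)" if "norm x \<le> \<epsilon>" for x
    using D[of x] D[of 0] that e by (intro linear_compose_sub has_derivative_linear) auto
  define S where "S = (\<Sum>b\<in>Basis. L b)"
  show ?thesis
  proof (rule that[of S])
    fix x :: 'a assume x: "norm x \<le> \<epsilon>"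
    have on: "onorm (\<lambda>v. ?D z v - ?D 0 v) \<le> S * norm x" if z: "norm z \<le> norm x" for z
    proof (rule onorm_bound)
      fix v :: 'a
      have ze: "norm z \<le> \<epsilon>" using z x by linarith
      have "norm (?D z v - ?D 0 v) = norm (\<Sum>b\<in>Basis. (v \<bullet> b) *\<^sub>R (?D z b - ?D 0 b))"
        using linear_sum[OF lin[OF ze], of "\<lambda>b. (v \<bullet> b) *\<^sub>R b" Basis]
        by (simp add: euclidean_representation linear_cmul[OF lin[OF ze]])
      also have "\<dots> \<le> (\<Sum>b\<in>Basis. norm ((v \<bullet> b) *\<^sub>R (?D z b - ?D 0 b)))"
        by (rule norm_sum)
      also have "\<dots> \<le> (\<Sum>b\<in>Basis. norm v * (L b * norm x))"
      proof (rule sum_mono)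
        fix b :: 'a assume b: "b \<in> Basis"
        have "L b * norm z \<le> L b * norm x" using L(1) z by (intro mult_left_mono) auto
        then have "norm (?D z b - ?D 0 b) \<le> L b * norm x" using L(2)[OF ze, of b] by linarith
        then have "\<bar>v \<bullet> b\<bar> * norm (?D z b - ?D 0 b) \<le> norm v * (L b * norm x)"
          using Basis_le_norm[OF b, of v] by (intro mult_mono) auto
        then show "norm ((v \<bullet> b) *\<^sub>R (?D z b - ?D 0 b)) \<le> norm v * (L b * norm x)" by simp
      qed
      also have "\<dots> = S * norm x * norm v"
        by (simp add: S_def sum_distrib_left sum_distrib_right mult_ac)
      finally show "norm (?D z v - ?D 0 v) \<le> S * norm x * norm v" .
    qed (use L(1) in \<open>simp add: S_def sum_nonneg\<close>)
    have "norm ((f x - ?D 0 x) - (f 0 - ?D 0 0)) \<le> S * norm x * norm (x - 0)"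
    proof (rule differentiable_bound[of "cball 0 (norm x)" _ "\<lambda>z v. ?D z v - ?D 0 v"])
      fix z :: 'a assume z: "z \<in> cball 0 (norm x)"
      then show "onorm (\<lambda>v. ?D z v - ?D 0 v) \<le> S * norm x" using on by auto
      have "(?D 0 has_derivative ?D 0) (at z)"
        using D[of 0] e by (intro bounded_linear_imp_has_derivative has_derivative_bounded_linear) auto
      then show "((\<lambda>z. f z - ?D 0 z) has_derivative (\<lambda>v. ?D z v - ?D 0 v)) (at z within cball 0 (norm x))"
        using D[of z] z x by (intro has_derivative_at_withinI[OF has_derivative_diff]) auto
    qed auto
    moreover have "?D 0 0 = 0" using D[of 0] e has_derivative_linear linear_0 by auto
    ultimately show "norm (f x - (f 0 + ?D 0 x)) \<le> S * (norm x)\<^sup>2"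
      by (simp add: algebra_simps power2_eq_square)
  qed
qed

text \<open>Taylor expansion along rays, uniform because all directions have length 1. The pairing
  with \<open>e\<close> extracts single entries of matrix-valued maps.\<close>

lemma expn_Ck_on:
  fixes F :: "'a::euclidean_space \<Rightarrow> 'b::euclidean_space" and w :: "'u \<Rightarrow> 'a"
  assumes F: "Ck_on 2 F V" "open V" "0 \<in> V" and w: "\<forall>u\<in>K. norm (w u) = 1"
  shows "expn K (\<lambda>r u. F (r *\<^sub>R w u) \<bullet> e) (\<lambda>u. F 0 \<bullet> e) (\<lambda>u. frechet_derivative F (at 0) (w u) \<bullet> e)"
proof -
  from F obtain \<epsilon> where e: "\<epsilon> > 0" "cball 0 \<epsilon> \<subseteq> V" using open_contains_cball by blast
  from Ck_on_Taylor[OF F(1,2) e(2)] e obtain L where L: "\<And>x. norm x \<le> \<epsilon> \<Longrightarrow>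
     norm (F x - (F 0 + frechet_derivative F (at 0) x)) \<le> L * (norm x)\<^sup>2" by auto
  let ?D = "frechet_derivative F (at 0)"
  have "(F has_derivative ?D) (at 0)"
    using Ck_on_Suc_D[of "Suc 0" F V 0] F by (simp only: numeral_2_eq_2)
  then have bl: "bounded_linear ?D" by (rule has_derivative_bounded_linear)
  show ?thesis
  proof (rule expnI[where Ca="\<bar>F 0 \<bullet> e\<bar>" and Cb="onorm ?D * norm e" and C="\<bar>L\<bar> * norm e"])
    fix u assume u: "u \<in> K"
    have "\<bar>?D (w u) \<bullet> e\<bar> \<le> norm (?D (w u)) * norm e" by (rule Cauchy_Schwarz_ineq2)
    also have "\<dots> \<le> onorm ?D * norm e" using onorm[OF bl, of "w u"] bspec[OF w u] by (intro mult_right_mono) auto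
    finally show "\<bar>?D (w u) \<bullet> e\<bar> \<le> onorm ?D * norm e" .
  next
    show "\<forall>\<^sub>F r in at_right 0. \<forall>u\<in>K. \<bar>F (r *\<^sub>R w u) \<bullet> e - (F 0 \<bullet> e + r * (?D (w u) \<bullet> e))\<bar>
        \<le> \<bar>L\<bar> * norm e * r\<^sup>2"
      using eventually_at_right_0_less[OF e(1)]
    proof eventually_elim
      case (elim r)
      show ?case
      proof
        fix u assume u: "u \<in> K"
        have n: "norm (r *\<^sub>R w u) = r" using elim bspec[OF w u] by simp
        have "F (r *\<^sub>R w u) \<bullet> e - (F 0 \<bullet> e + r * (?D (w u) \<bullet> e)) = (F (r *\<^sub>R w u) - (F 0 + ?D (r *\<^sub>R w u))) \<bullet> e"
          by (simp add: algebra_simps linear_cmul[OF bounded_linear.linear[OF bl]] inner_add_left inner_diff_left)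
        also have "\<bar>\<dots>\<bar> \<le> norm (F (r *\<^sub>R w u) - (F 0 + ?D (r *\<^sub>R w u))) * norm e"
          by (rule Cauchy_Schwarz_ineq2)
        also have "\<dots> \<le> (\<bar>L\<bar> * r\<^sup>2) * norm e"
        proof (rule mult_right_mono)
          have "L * r\<^sup>2 \<le> \<bar>L\<bar> * r\<^sup>2" by (intro mult_right_mono) auto
          then show "norm (F (r *\<^sub>R w u) - (F 0 + ?D (r *\<^sub>R w u))) \<le> \<bar>L\<bar> * r\<^sup>2"
            using L[of "r *\<^sub>R w u"] n elim by (simp only: n) linarith
        qed simp
        finally show "\<bar>F (r *\<^sub>R w u) \<bullet> e - (F 0 \<bullet> e + r * (?D (w u) \<bullet> e))\<bar> \<le> \<bar>L\<bar> * norm e * r\<^sup>2"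
          by (simp add: mult_ac)
      qed
    qed
  qed auto
qed

section \<open>Surfaces with a given Euclidean conormal\<close>

lemma matrix_inv_eqI:
  fixes M N :: "real^'n^'n"
  assumes "M ** N = mat 1"
  shows "matrix_inv M = N"
proof -
  have NM: "N ** M = mat 1" using assms matrix_left_right_inverse by blast
  have "\<exists>N'. M ** N' = mat 1 \<and> N' ** M = mat 1" using assms NM by blast
  then have "M ** matrix_inv M = mat 1"
    unfolding matrix_inv_def by (rule someI2_ex) auto
  then have "N ** (M ** matrix_inv M) = N" by simp
  then show ?thesis by (simp add: matrix_mul_assoc NM)
qed

lemma matrix_inv_mat_1: "matrix_inv (mat 1 :: real^'n^'n) = mat 1"
  by (rule matrix_inv_eqI) simp

definition adj3 :: "real^3^3 \<Rightarrow> real^3^3" where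
  "adj3 M = vector
    [vector [M$2$2 * M$3$3 - M$2$3 * M$3$2, M$1$3 * M$3$2 - M$1$2 * M$3$3, M$1$2 * M$2$3 - M$1$3 * M$2$2],
     vector [M$2$3 * M$3$1 - M$2$1 * M$3$3, M$1$1 * M$3$3 - M$1$3 * M$3$1, M$1$3 * M$2$1 - M$1$1 * M$2$3],
     vector [M$2$1 * M$3$2 - M$2$2 * M$3$1, M$1$2 * M$3$1 - M$1$1 * M$3$2, M$1$1 * M$2$2 - M$1$2 * M$2$1]]"

lemma matrix_mult_adj3: "M ** adj3 M = det M *\<^sub>R mat 1"
  by (simp add: vec_eq_iff forall_3 matrix_matrix_mult_def sum_3 adj3_def det_3 mat_def algebra_simps)

lemma matrix_inv_3:
  assumes "det M \<noteq> 0"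
  shows "matrix_inv (M::real^3^3) = inverse (det M) *\<^sub>R adj3 M"
proof (rule matrix_inv_eqI)
  have "M ** (inverse (det M) *\<^sub>R adj3 M) = inverse (det M) *\<^sub>R (M ** adj3 M)"
    by (simp add: vec_eq_iff matrix_matrix_mult_def sum_distrib_left mult_ac)
  then show "M ** (inverse (det M) *\<^sub>R adj3 M) = mat 1"
    using assms by (simp add: matrix_mult_adj3)
qed

text \<open>The numerator is the polarization of the 2x2 determinant, which turns the mean curvature
  into a mixed Gram determinant divided by a pure one.\<close>

lemma trace_matrix_inv_2:
  fixes M N :: "real^2^2"
  assumes "det M \<noteq> 0"
  shows "trace (matrix_inv M ** N) =
    (M$1$1 * N$2$2 + M$2$2 * N$1$1 - M$1$2 * N$2$1 - M$2$1 * N$1$2) / det M"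
proof -
  define d where "d = det M"
  have d: "d \<noteq> 0" "M$1$1 * M$2$2 = d + M$1$2 * M$2$1" using assms by (auto simp: d_def det_2)
  have "matrix_inv M = (\<chi> i j. vector [vector [M$2$2, - (M$1$2)], vector [- (M$2$1), M$1$1]] $ i $ j / d)"
    using d(1) by (intro matrix_inv_eqI)
      (auto simp: vec_eq_iff forall_2 matrix_matrix_mult_def sum_2 mat_def field_simps d(2))
  then show ?thesis unfolding d_def[symmetric]
    by (simp add: trace_def matrix_matrix_mult_def sum_2 diff_divide_distrib add_divide_distrib)
qed

text \<open>For invertible M this is det M times the squared length of the covector w in the dual
  metric; in this form it is polynomial in M.\<close>

definition adjoint_form :: "real^3^3 \<Rightarrow> real^3 \<Rightarrow> real" where
  "adjoint_form M w = ip (adj3 M) w w"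

text \<open>The adjugate is quadratic in a 3x3 matrix; this is its polarization, equal to 2
  \<open>adjoint_form M w\<close> when B = M.\<close>

definition polar_form :: "real^3^3 \<Rightarrow> real^3^3 \<Rightarrow> real^3 \<Rightarrow> real" where
  "polar_form M B w = adjoint_form (M + B) w - adjoint_form M w - adjoint_form B w"

lemma ip_3: "ip M v w = (\<Sum>i\<in>UNIV. \<Sum>j\<in>UNIV. M $ i $ j * v $ i * w $ j)"
  by (simp add: ip_def inner_vec_def matrix_vector_mult_def sum_distrib_left mult_ac)

lemma ip_add: "ip (M + N) v w = ip M v w + ip N v w"
  by (simp add: ip_3 sum.distrib algebra_simps)

lemma ip_diff: "ip (M - N) v w = ip M v w - ip N v w"
  by (simp add: ip_3 sum_subtractf algebra_simps)

lemma ip_scaleR: "ip (c *\<^sub>R M) v w = c * ip M v w"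
  by (simp add: ip_3 sum_distrib_left mult_ac)

lemma ip_mat_1: "ip (mat 1) v w = v \<bullet> w"
  by (simp add: ip_def)

lemma ip_symmetric: "transpose M = M \<Longrightarrow> ip M v w = ip M w v"
  by (metis ip_def dot_lmul_matrix inner_commute transpose_matrix_vector)

text \<open>Cauchy-Binet: the 2x2 Gram determinant is the cofactor form evaluated at the vector of
  minors of (a, b), which is the cross product.\<close>

lemma gram_adjoint_form:
  "ip M a a * ip M b b - ip M a b * ip M b a = adjoint_form M (cross3 a b)"
  by (simp add: ip_3 sum_3 adjoint_form_def adj3_def cross3_def algebra_simps)

lemma adjoint_form_scaleR: "adjoint_form M (c *\<^sub>R w) = c\<^sup>2 * adjoint_form M w"
  by (simp add: adjoint_form_def ip_3 sum_3 power2_eq_square algebra_simps)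

text \<open>Polarization of \<open>gram_adjoint_form\<close> in the matrix; it matches the numerator
  in \<open>trace_matrix_inv_2\<close>.\<close>

lemma gram_polar_form:
  "ip M a a * ip B b b + ip M b b * ip B a a - ip M a b * ip B b a - ip M b a * ip B a b
     = polar_form M B (cross3 a b)"
  unfolding polar_form_def gram_adjoint_form[symmetric] ip_add by (simp add: algebra_simps)

text \<open>The unit normal of a surface with Euclidean conormal \<open>w\<close> is a multiple of \<open>g\<^sup>-\<^sup>1 w\<close>, so that
  \<open>II\<close> only involves the Euclidean product of the covariant derivatives with \<open>w\<close>.\<close>

lemma willmore_density:
  fixes w :: "real^3"
  assumes sym: "transpose (g (X u)) = g (X u)"
    and pos: "det (g (X u)) > 0" "adjoint_form (g (X u)) w > 0"
    and w: "cross3 (partial_on D X 1 u) (partial_on D X 2 u) = \<sigma> *\<^sub>R w" "\<sigma> > 0"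
    and Z: "\<And>i j. cov_deriv S g D X i j u \<bullet> w = \<kappa> * ip B (partial_on D X i u) (partial_on D X j u)"
  defines "n \<equiv> inverse (sqrt (det (g (X u)) * adjoint_form (g (X u)) w)) *\<^sub>R (adj3 (g (X u)) *v w)"
  shows "unit_normal g D X u n"
    and "(mean_curvature S g D X n u)\<^sup>2 * sqrt (det (first_form g D X u)) =
      \<kappa>\<^sup>2 * \<sigma> * ((polar_form (g (X u)) B w)\<^sup>2 * det (g (X u)) *
        (inverse (adjoint_form (g (X u)) w))\<^sup>2 * inverse (sqrt (adjoint_form (g (X u)) w)))"
proof -
  define M where "M = g (X u)"
  have symM: "transpose M = M" using sym by (simp add: M_def)
  define E where "E = adjoint_form M w"
  define \<Delta> where "\<Delta> = det M"
  define X1 where "X1 = partial_on D X 1 u"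
  define X2 where "X2 = partial_on D X 2 u"
  define s where "s = inverse (sqrt (\<Delta> * E))"
  have pos': "\<Delta> > 0" "E > 0" using pos by (auto simp: M_def E_def \<Delta>_def)
  \<comment> \<open>The vector adj(M) w has squared M-length \<Delta> E, so s is the factor that
    normalizes it.\<close>
  have s: "s > 0" "s\<^sup>2 * (\<Delta> * E) = 1" using pos' by (auto simp: s_def power_inverse field_simps)
  have n: "n = s *\<^sub>R (adj3 M *v w)" by (simp add: n_def s_def \<Delta>_def E_def M_def)
  have "M *v (adj3 M *v w) = \<Delta> *\<^sub>R w"
    by (simp add: matrix_vector_mul_assoc matrix_mult_adj3 \<Delta>_def scaleR_matrix_vector_assoc[symmetric])
  then have Mn: "ip M v n = s * \<Delta> * (v \<bullet> w)" for v
    by (simp add: ip_def n matrix_vector_mult_scaleR)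
  have orth: "cross3 X1 X2 \<bullet> X1 = 0" "cross3 X1 X2 \<bullet> X2 = 0"
    by (simp_all add: dot_cross_self)
  then have wX: "w \<bullet> X1 = 0" "w \<bullet> X2 = 0" using w by (simp_all add: X1_def X2_def)
  have "ip M n (partial_on D X i u) = 0" for i
    using exhaust_2[of i] wX
    by (auto simp: ip_symmetric[OF symM, of n] Mn X1_def X2_def inner_commute)
  moreover have "n \<bullet> w = s * E" by (simp add: n E_def adjoint_form_def ip_def inner_commute)
  then have "ip M n n = 1"
    using s by (simp add: Mn power2_eq_square mult_ac)
  ultimately show "unit_normal g D X u n" by (simp add: unit_normal_def M_def)
  define I where "I = first_form g D X u"
  define II where "II = second_form S g D X n u"
  have I: "I$1$1 = ip M X1 X1" "I$1$2 = ip M X1 X2" "I$2$1 = ip M X2 X1" "I$2$2 = ip M X2 X2"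
    by (simp_all add: I_def first_form_def M_def X1_def X2_def)
  have II: "II$1$1 = s*\<Delta>*\<kappa> * ip B X1 X1" "II$1$2 = s*\<Delta>*\<kappa> * ip B X1 X2"
     "II$2$1 = s*\<Delta>*\<kappa> * ip B X2 X1" "II$2$2 = s*\<Delta>*\<kappa> * ip B X2 X2"
    using Mn by (simp_all add: II_def second_form_def X1_def X2_def Z flip: M_def)
  have detI: "det I = \<sigma>\<^sup>2 * E"
    by (simp add: det_2 I gram_adjoint_form E_def w X1_def X2_def adjoint_form_scaleR)
  have "polar_form M B (cross3 X1 X2) = \<sigma>\<^sup>2 * polar_form M B w"
    by (simp add: polar_form_def w X1_def X2_def adjoint_form_scaleR algebra_simps)
  moreover have "I$1$1 * II$2$2 + I$2$2 * II$1$1 - I$1$2 * II$2$1 - I$2$1 * II$1$2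
     = s*\<Delta>*\<kappa> * polar_form M B (cross3 X1 X2)"
    unfolding I II gram_polar_form[symmetric] by (simp add: algebra_simps)
  ultimately have num: "I$1$1 * II$2$2 + I$2$2 * II$1$1 - I$1$2 * II$2$1 - I$2$1 * II$1$2
     = s*\<Delta>*\<kappa> * (\<sigma>\<^sup>2 * polar_form M B w)" by simp
  have "mean_curvature S g D X n u = s*\<Delta>*\<kappa> * polar_form M B w / E"
    using w(2) pos' by (simp add: mean_curvature_def trace_matrix_inv_2 detI num flip: I_def II_def)
  \<comment> \<open>H^2 carries s^2 \<Delta>^2 / E^2 and the area density carries sqrt E. As s^2
    \<Delta> E = 1, the total is \<Delta> times E to the power -5/2.\<close>
  then have "(mean_curvature S g D X n u)\<^sup>2 * sqrt (det I)
     = (s\<^sup>2 * (\<Delta> * E)) * \<Delta> * \<kappa>\<^sup>2 * (polar_form M B w)\<^sup>2 / E^3 * (\<sigma> * sqrt E)"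
    using pos' w(2)
    by (simp add: detI real_sqrt_mult power_mult_distrib power_divide power2_eq_square power3_eq_cube)
  also have "\<dots> = \<Delta> * \<kappa>\<^sup>2 * (polar_form M B w)\<^sup>2 / E^3 * (\<sigma> * sqrt E)"
    unfolding s by simp
  also have "\<dots> = \<kappa>\<^sup>2 * \<sigma> * ((polar_form M B w)\<^sup>2 * \<Delta> * (inverse E)\<^sup>2 * inverse (sqrt E))"
  proof -
    have "sqrt E / E^3 = (inverse E)\<^sup>2 * inverse (sqrt E)"
      using pos' by (simp add: field_simps power3_eq_cube power2_eq_square)
    moreover have "\<Delta> * \<kappa>\<^sup>2 * (polar_form M B w)\<^sup>2 / E^3 * (\<sigma> * sqrt E)
       = \<kappa>\<^sup>2 * \<sigma> * ((polar_form M B w)\<^sup>2 * \<Delta> * (sqrt E / E^3))" by (simp add: mult_ac)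
    ultimately show ?thesis by (simp only: mult.assoc)
  qed
  finally show "(mean_curvature S g D X n u)\<^sup>2 * sqrt (det (first_form g D X u)) =
      \<kappa>\<^sup>2 * \<sigma> * ((polar_form (g (X u)) B w)\<^sup>2 * det (g (X u)) *
        (inverse (adjoint_form (g (X u)) w))\<^sup>2 * inverse (sqrt (adjoint_form (g (X u)) w)))"
    by (simp add: I_def M_def E_def \<Delta>_def)
qed

section \<open>Spherical coordinates, with the polar angle measured from the y-axis\<close>

definition sph :: "real^2 \<Rightarrow> real^3" where
  "sph u = vector [sin (u$1) * cos (u$2), sin (u$1) * sin (u$2), cos (u$1)]"

definition sph_tangent :: "2 \<Rightarrow> real^2 \<Rightarrow> real^3" where
  "sph_tangent i u = (if i = 1 then vector [cos (u$1) * cos (u$2), cos (u$1) * sin (u$2), - sin (u$1)]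
     else vector [- sin (u$1) * sin (u$2), sin (u$1) * cos (u$2), 0])"

lemma vector_3_expand:
  "(vector [a, b, c] :: real^3) = a *\<^sub>R axis 1 1 + b *\<^sub>R axis 2 1 + c *\<^sub>R axis 3 1"
  by (simp add: vec_eq_iff forall_3 axis_def)

lemma has_vector_derivative_vector_3:
  assumes "(f has_vector_derivative a) F" "(g has_vector_derivative b) F" "(h has_vector_derivative c) F"
  shows "((\<lambda>t. vector [f t, g t, h t] :: real^3) has_vector_derivative vector [a, b, c]) F"
  unfolding vector_3_expand using assms
  by (auto simp: has_vector_derivative_def intro!: derivative_eq_intros) (auto simp: algebra_simps)

lemma partial_on_eqI:
  fixes f :: "real^'n \<Rightarrow> 'b::real_normed_vector"
  assumes "open D" "x \<in> D" "((\<lambda>t. f (x + t *\<^sub>R axis i 1)) has_vector_derivative d) (at 0)"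
  shows "partial_on D f i x = d"
proof -
  have "open {t. x + t *\<^sub>R axis i 1 \<in> D}"
    using open_vimage[OF assms(1), of "\<lambda>t. x + t *\<^sub>R axis i 1"]
    by (simp add: vimage_def continuous_intros)
  then have "at 0 within {t. x + t *\<^sub>R axis i 1 \<in> D} = at 0"
    using assms(2) by (intro at_within_open) auto
  then show ?thesis using assms(3) vector_derivative_at by (simp add: partial_on_def)
qed

lemma partial_on_cong:
  assumes "x \<in> S" "\<And>z. z \<in> S \<Longrightarrow> f z = h z"
  shows "partial_on S f i x = partial_on S h i x"
  unfolding partial_on_def
  by (rule vector_derivative_cong_eq) (use assms in auto)

lemma partial_on_sph:
  assumes "open D" "u \<in> D"
  shows "partial_on D (\<lambda>u. r *\<^sub>R sph u) i u = r *\<^sub>R sph_tangent i u"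
proof (rule partial_on_eqI[OF assms])
  have "((\<lambda>t. sph (u + t *\<^sub>R axis i 1)) has_vector_derivative sph_tangent i u) (at 0)"
    using exhaust_2[of i] unfolding sph_def sph_tangent_def
    by (auto intro!: has_vector_derivative_vector_3 derivative_eq_intros
          simp: axis_def simp flip: has_real_derivative_iff_has_vector_derivative)
  then show "((\<lambda>t. r *\<^sub>R sph (u + t *\<^sub>R axis i 1)) has_vector_derivative r *\<^sub>R sph_tangent i u) (at 0)"
    by (rule has_vector_derivative_scaleR[OF DERIV_const, simplified])
qed

section \<open>Integration over the hemisphere\<close>

definition pair_vec :: "real \<times> real \<Rightarrow> real^2" where
  "pair_vec p = vector [fst p, snd p]"

definition vec_pair :: "real^2 \<Rightarrow> real \<times> real" where
  "vec_pair u = (u$1, u$2)"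

lemma vec_pair_inverse: "pair_vec (vec_pair u) = u" "vec_pair (pair_vec p) = p"
  by (simp_all add: pair_vec_def vec_pair_def vec_eq_iff forall_2)

lemma pair_vec_cbox: "pair_vec ` cbox (a, b) (c, d) = cbox (vector [a, b]) (vector [c, d])"
proof (intro equalityI subsetI)
  fix u assume "u \<in> cbox (vector [a, b]) (vector [c, d] :: real^2)"
  then have "vec_pair u \<in> cbox (a, b) (c, d)"
    by (simp add: vec_pair_def mem_box_cart forall_2 cbox_Pair_eq)
  then show "u \<in> pair_vec ` cbox (a, b) (c, d)" by (metis image_eqI vec_pair_inverse(1))
qed (auto simp: pair_vec_def mem_box_cart forall_2 cbox_Pair_eq)

lemma vec_pair_cbox: "vec_pair ` cbox a b = cbox (vec_pair a) (vec_pair b)"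
proof -
  have "cbox a b = pair_vec ` cbox (vec_pair a) (vec_pair b)"
    using pair_vec_cbox[of "a$1" "a$2" "b$1" "b$2"] vec_pair_inverse(1)
    by (simp add: vec_pair_def pair_vec_def)
  then show ?thesis by (simp add: image_image vec_pair_inverse)
qed

lemma content_pair_vec: "measure lborel (pair_vec ` cbox u v) = 1 * measure lborel (cbox u v)"
proof (cases "cbox u v = {}")
  case False
  obtain a b c d where u: "u = (a, b)" and v: "v = (c, d)" by (cases u, cases v)
  have "pair_vec ` cbox u v \<noteq> {}" using False by simp
  then have "measure lborel (pair_vec ` cbox u v) = (c - a) * (d - b)"
    by (simp add: u v pair_vec_cbox content_cbox_cart UNIV_2)
  moreover have "a \<le> c" "b \<le> d" using False by (auto simp: u v cbox_Pair_eq)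
  then have "measure lborel (cbox u v) = (c - a) * (d - b)"
    by (simp add: u v content_Pair)
  ultimately show ?thesis by simp
qed simp

lemma continuous_pair_vec: "continuous (at p) pair_vec"
proof -
  have eq: "pair_vec = (\<lambda>p. fst p *\<^sub>R axis 1 1 + snd p *\<^sub>R axis 2 1)"
    by (auto simp: fun_eq_iff pair_vec_def vec_eq_iff forall_2 axis_def)
  show ?thesis unfolding eq by (intro continuous_intros)
qed

text \<open>The identification \<open>pair_vec\<close> maps boxes to boxes of equal volume, so the
  integral is carried over to pairs, where Fubini applies.\<close>

lemma integral_vec_2:
  fixes f :: "real^2 \<Rightarrow> real"
  assumes f: "continuous_on (cbox (vector [a, b]) (vector [c, d])) f"
  shows "integral (cbox (vector [a, b]) (vector [c, d])) f
     = integral {a..c} (\<lambda>x. integral {b..d} (\<lambda>y. f (vector [x, y])))"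
proof -
  let ?K = "cbox (vector [a, b]) (vector [c, d] :: real^2)"
  have "(f has_integral integral ?K f) ?K"
    using f integrable_continuous by blast
  then have "((\<lambda>p. f (pair_vec p)) has_integral (1 / 1) *\<^sub>R integral ?K f) (vec_pair ` ?K)"
  proof (rule has_integral_twiddle[OF zero_less_one vec_pair_inverse(2,1) continuous_pair_vec _ _ content_pair_vec, rotated 2])
    show "\<exists>w z. pair_vec ` cbox x y = cbox w z" for x y
      using pair_vec_cbox by (metis surj_pair)
    show "\<exists>w z. vec_pair ` cbox x y = cbox w z" for x y
      using vec_pair_cbox by blast
  qed
  moreover have im: "vec_pair ` ?K = cbox (a, b) (c, d)"
    unfolding vec_pair_cbox by (simp add: vec_pair_def)
  ultimately have "integral (cbox (a, b) (c, d)) (\<lambda>p. f (pair_vec p)) = integral ?K f"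
    by (intro integral_unique) (simp add: im)
  moreover have "continuous_on (cbox (a, b) (c, d)) (\<lambda>p. f (pair_vec p))"
    by (rule continuous_on_compose2[OF f])
      (auto intro: continuous_at_imp_continuous_on continuous_pair_vec simp flip: pair_vec_cbox)
  ultimately show ?thesis
    by (simp add: integral_prod_continuous pair_vec_def)
qed

lemma integral_real_FTC:
  fixes f :: "real \<Rightarrow> real"
  assumes "a \<le> b" "\<And>x. (F has_real_derivative f x) (at x)"
  shows "integral {a..b} f = F b - F a"
  using assms by (intro integral_unique fundamental_theorem_of_calculus)
    (auto simp flip: has_real_derivative_iff_has_vector_derivative intro: has_field_derivative_at_within)

text \<open>The azimuthal integrals of cos^2, sin cos and sin^2 are pi, 0 and pi, so the mixed
  coefficient b drops out. The polar integral of cos sin^3 over [0, pi/2] is 1/4, whence the factor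
  8 pi / 4 = 2 pi.\<close>

lemma hemisphere_integral:
  fixes r a b c :: real
  defines "f \<equiv> \<lambda>u::real^2. sin (u$1) * (4 + 8 * r * cos (u$1) *
     (a * (sin (u$1) * cos (u$2))\<^sup>2 + b * (sin (u$1) * cos (u$2)) * (sin (u$1) * sin (u$2)) + c * (sin (u$1) * sin (u$2))\<^sup>2))"
  shows "integral (cbox (vector [0, 0]) (vector [pi/2, 2 * pi])) f = 8 * pi + 2 * pi * (a + c) * r"
proof -
  have inner: "integral {0..2*pi} (\<lambda>y. f (vector [x, y]))
     = 8 * pi * sin x + 8 * r * pi * (a + c) * (cos x * sin x ^ 3)" for x
  proof -
    let ?F = "\<lambda>y. 4 * sin x * y + 8 * r * cos x * sin x ^ 3 *
       (a * (y / 2 + sin y * cos y / 2) + b * ((sin y)\<^sup>2 / 2) + c * (y / 2 - sin y * cos y / 2))"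
    have "(?F has_real_derivative f (vector [x, y])) (at y)" for y
    proof -
      have "(?F has_real_derivative 4 * sin x + 8 * r * cos x * sin x ^ 3 *
         (a * (1 / 2 + (cos y * cos y - sin y * sin y) / 2) + b * (sin y * cos y) + c * (1 / 2 - (cos y * cos y - sin y * sin y) / 2))) (at y)"
        by (auto intro!: derivative_eq_intros simp: field_simps power2_eq_square)
      moreover have "1 / 2 + (cos y * cos y - sin y * sin y) / 2 = (cos y)\<^sup>2"
        "1 / 2 - (cos y * cos y - sin y * sin y) / 2 = (sin y)\<^sup>2"
        by (simp_all add: sin_squared_eq field_simps flip: power2_eq_square)
      ultimately have "(?F has_real_derivative 4 * sin x + 8 * r * cos x * sin x ^ 3 *
         (a * (cos y)\<^sup>2 + b * (sin y * cos y) + c * (sin y)\<^sup>2)) (at y)" by simp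
      then show ?thesis by (rule DERIV_cong) (simp add: f_def algebra_simps power2_eq_square power3_eq_cube)
    qed
    from integral_real_FTC[OF _ this, of 0 "2*pi"] show ?thesis by (simp add: algebra_simps)
  qed
  have "continuous_on (cbox (vector [0, 0]) (vector [pi/2, 2 * pi])) f"
    unfolding f_def by (intro continuous_intros)
  then have "integral (cbox (vector [0, 0]) (vector [pi/2, 2 * pi])) f =
     integral {0..pi/2} (\<lambda>x. 8 * pi * sin x + 8 * r * pi * (a + c) * (cos x * sin x ^ 3))"
    by (simp add: integral_vec_2 inner)
  also have "\<dots> = 8 * pi + 2 * pi * (a + c) * r"
  proof -
    let ?F = "\<lambda>x. - 8 * pi * cos x + 2 * r * pi * (a + c) * sin x ^ 4"
    have "(?F has_real_derivative 8 * pi * sin x + 8 * r * pi * (a + c) * (cos x * sin x ^ 3)) (at x)" for x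
      by (auto intro!: derivative_eq_intros simp: algebra_simps)
    from integral_real_FTC[OF _ this, of 0 "pi/2"] show ?thesis by (simp add: algebra_simps)
  qed
  finally show ?thesis .
qed

section \<open>The coordinate hemisphere\<close>

lemma norm_sph: "norm (sph u) = 1"
proof -
  have "(sin (u$1))\<^sup>2 + (cos (u$1))\<^sup>2 = 1" "(sin (u$2))\<^sup>2 + (cos (u$2))\<^sup>2 = 1" by simp_all
  then have "(sin (u$1) * cos (u$2))\<^sup>2 + (sin (u$1) * sin (u$2))\<^sup>2 + (cos (u$1))\<^sup>2 = 1" by algebra
  then show ?thesis
    by (simp add: norm_vec_def L2_set_def sum_3 sph_def)
qed

text \<open>Supplies the conormal for \<open>willmore_density\<close>: scaled to radius r, the cross
  product is r^2 sin times the unit vector \<open>sph u\<close>.\<close>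

lemma cross_sph_tangent: "cross3 (sph_tangent 1 u) (sph_tangent 2 u) = sin (u$1) *\<^sub>R sph u"
proof -
  have "(sin (u$2))\<^sup>2 + (cos (u$2))\<^sup>2 = 1" by simp
  then have "cos (u$1) * cos (u$2) * (sin (u$1) * cos (u$2)) - cos (u$1) * sin (u$2) * (- sin (u$1) * sin (u$2))
    = sin (u$1) * cos (u$1)" by algebra
  then show ?thesis
    by (simp add: cross3_def sph_tangent_def sph_def vec_eq_iff forall_3 algebra_simps)
qed

definition sph_second :: "2 \<Rightarrow> 2 \<Rightarrow> real^2 \<Rightarrow> real^3" where
  "sph_second i j u = (if i = 1 \<and> j = 1 then - sph u
     else if i = 2 \<and> j = 2 then vector [- sin (u$1) * cos (u$2), - sin (u$1) * sin (u$2), 0]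
     else vector [- cos (u$1) * sin (u$2), cos (u$1) * cos (u$2), 0])"

lemma sph_second_inner: "sph_second i j u \<bullet> sph u = - (sph_tangent i u \<bullet> sph_tangent j u)"
proof -
  have 1: "(sin (u$1))\<^sup>2 + (cos (u$1))\<^sup>2 = 1" and 2: "(sin (u$2))\<^sup>2 + (cos (u$2))\<^sup>2 = 1" by simp_all
  show ?thesis
  proof (cases "i = 1 \<and> j = 1")
    case True
    have "(cos (u$1) * cos (u$2))\<^sup>2 + (cos (u$1) * sin (u$2))\<^sup>2 + (sin (u$1))\<^sup>2 = 1" using 1 2 by algebra
    moreover have "sph u \<bullet> sph u = 1" by (simp add: norm_sph dot_square_norm)
    ultimately show ?thesis using True
      by (simp add: sph_second_def sph_tangent_def inner_vec_def sum_3 power2_eq_square)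
  next
    case False
    then show ?thesis
      using exhaust_2[of i] exhaust_2[of j]
      by (auto simp: sph_second_def sph_tangent_def sph_def inner_vec_def sum_3 algebra_simps)
  qed
qed

lemma partial_on_sph_tangent:
  assumes "open D" "u \<in> D"
  shows "partial_on D (\<lambda>u. r *\<^sub>R sph_tangent j u) i u = r *\<^sub>R sph_second i j u"
proof (rule partial_on_eqI[OF assms])
  have "((\<lambda>t. sph_tangent j (u + t *\<^sub>R axis i 1)) has_vector_derivative sph_second i j u) (at 0)"
  proof (cases "j = 1")
    case True
    have "sph_second i 1 u = (if i = 1 then vector [- sin (u$1) * cos (u$2), - sin (u$1) * sin (u$2), - cos (u$1)]
      else vector [- cos (u$1) * sin (u$2), cos (u$1) * cos (u$2), 0])"
      by (auto simp: sph_second_def sph_def vec_eq_iff forall_3)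
    then show ?thesis
      using exhaust_2[of i] unfolding True sph_tangent_def
      by (auto intro!: has_vector_derivative_vector_3 derivative_eq_intros
          simp: axis_def simp flip: has_real_derivative_iff_has_vector_derivative)
  next
    case False
    then have "j = 2" using exhaust_2[of j] by auto
    then show ?thesis
      using exhaust_2[of i] unfolding sph_second_def sph_tangent_def
      by (auto intro!: has_vector_derivative_vector_3 derivative_eq_intros
          simp: axis_def simp flip: has_real_derivative_iff_has_vector_derivative)
  qed
  then show "((\<lambda>t. r *\<^sub>R sph_tangent j (u + t *\<^sub>R axis i 1)) has_vector_derivative r *\<^sub>R sph_second i j u) (at 0)"
    by (rule has_vector_derivative_scaleR[OF DERIV_const, simplified])
qed

definition christoffel_contraction ::
  "(real^3) set \<Rightarrow> (real^3 \<Rightarrow> real^3^3) \<Rightarrow> real^3 \<Rightarrow> real^3 \<Rightarrow> real^3^3" where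
  "christoffel_contraction S g w v = (\<chi> a b. \<Sum>k\<in>UNIV. w $ k * christoffel S g k a b v)"

text \<open>Differentiating \<open>X \<bullet> X = r\<^sup>2\<close> twice turns the Euclidean second derivatives into
  \<open>- X\<^sub>i \<bullet> X\<^sub>j / r\<close>.\<close>

lemma cov_deriv_sph:
  assumes "open D" "u \<in> D" "r > 0"
  defines "X \<equiv> \<lambda>u. r *\<^sub>R sph u"
  shows "cov_deriv S g D X i j u \<bullet> sph u =
    - inverse r * ip (mat 1 - r *\<^sub>R christoffel_contraction S g (sph u) (X u)) (partial_on D X i u) (partial_on D X j u)"
proof -
  have P: "partial_on D X i u = r *\<^sub>R sph_tangent i u" if "u \<in> D" for i u
    unfolding X_def using assms that by (intro partial_on_sph)
  have "partial_on D (partial_on D X j) i u = r *\<^sub>R sph_second i j u"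
    using partial_on_cong[OF assms(2), of "partial_on D X j" "\<lambda>u. r *\<^sub>R sph_tangent j u"]
      partial_on_sph_tangent[OF assms(1,2)] P by simp
  then have "cov_deriv S g D X i j u \<bullet> sph u = - inverse r * (partial_on D X i u \<bullet> partial_on D X j u)
     + (\<Sum>k\<in>UNIV. \<Sum>a\<in>UNIV. \<Sum>b\<in>UNIV. christoffel S g k a b (X u) * partial_on D X i u $ a * partial_on D X j u $ b * sph u $ k)"
    using assms(3) P[OF assms(2)]
    by (simp add: cov_deriv_def inner_add_left sph_second_inner inner_vec_def[of "vec_lambda _"] sum_distrib_right)
  also have "(\<Sum>k\<in>UNIV. \<Sum>a\<in>UNIV. \<Sum>b\<in>UNIV. christoffel S g k a b (X u) * partial_on D X i u $ a * partial_on D X j u $ b * sph u $ k)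
     = ip (christoffel_contraction S g (sph u) (X u)) (partial_on D X i u) (partial_on D X j u)"
    by (simp add: ip_3 christoffel_contraction_def sum_3 algebra_simps)
  finally show ?thesis using assms(3) by (simp add: ip_diff ip_mat_1 ip_scaleR algebra_simps)
qed

text \<open>A derivative of a sine is a sine with phase shifted by pi/2, and the inner factor is
  absorbed into the coefficient. The class is thus closed under directional derivatives, and
  smoothness of all orders follows by induction over arbitrary phases and coefficients.\<close>

lemma Ck_on_sin_sum:
  fixes l :: "'i \<Rightarrow> 'a::euclidean_space" and c :: "'i \<Rightarrow> 'b::real_normed_vector"
  shows "Ck_on k (\<lambda>x. \<Sum>i\<in>I. sin (l i \<bullet> x + \<beta> i) *\<^sub>R c i) S"
proof (induction k arbitrary: \<beta> c)
  case 0
  show ?case by (auto intro!: continuous_intros)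
next
  case (Suc k)
  have D: "((\<lambda>x. \<Sum>i\<in>I. sin (l i \<bullet> x + \<beta> i) *\<^sub>R c i) has_derivative
    (\<lambda>v. \<Sum>i\<in>I. sin (l i \<bullet> x + (\<beta> i + pi/2)) *\<^sub>R ((l i \<bullet> v) *\<^sub>R c i))) (at x)" for x
    by (auto intro!: derivative_eq_intros simp: sin_add cos_add algebra_simps)
  have "frechet_derivative (\<lambda>x. \<Sum>i\<in>I. sin (l i \<bullet> x + \<beta> i) *\<^sub>R c i) (at x) v
    = (\<Sum>i\<in>I. sin (l i \<bullet> x + (\<beta> i + pi/2)) *\<^sub>R ((l i \<bullet> v) *\<^sub>R c i))" for x v
    by (simp add: frechet_derivative_at[OF D, symmetric])
  moreover have "(\<lambda>x. \<Sum>i\<in>I. sin (l i \<bullet> x + \<beta> i) *\<^sub>R c i) differentiable_on S"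
    using D by (auto simp: differentiable_on_def differentiable_def intro: has_derivative_at_withinI)
  \<comment> \<open>The nested scaling must survive, since l i \<bullet> v times c i is the new
    coefficient in the induction hypothesis.\<close>
  ultimately show ?case using Suc.IH by (simp del: scaleR_scaleR)
qed

text \<open>Product-to-sum formulas, with cosines written as sines of phase pi/2, bring
  \<open>sph\<close> into the form of \<open>Ck_on_sin_sum\<close>.\<close>

lemma sph_eq_sin_sum:
  "sph u = (\<Sum>i<5::nat. sin ([vector [1,1], vector [1,-1], vector [1,-1], vector [1,1], vector [1,0] :: real^2] ! i \<bullet> u
      + [0, 0, pi/2, pi/2, pi/2] ! i) *\<^sub>R
     [vector [1/2,0,0], vector [1/2,0,0], vector [0,1/2,0], vector [0,-1/2,0], vector [0,0,1] :: real^3] ! i)"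
  by (simp add: eval_nat_numeral inner_vec_def sum_2 vec_eq_iff forall_3 sph_def sin_add cos_add sin_diff cos_diff field_simps)

lemma Ck_on_sph: "Ck_on k (\<lambda>u. r *\<^sub>R sph u) S"
proof -
  have "(\<lambda>u. r *\<^sub>R sph u) = (\<lambda>u. \<Sum>i<5::nat. sin ([vector [1,1], vector [1,-1], vector [1,-1], vector [1,1], vector [1,0] :: real^2] ! i \<bullet> u
      + [0, 0, pi/2, pi/2, pi/2] ! i) *\<^sub>R (r *\<^sub>R
     [vector [1/2,0,0], vector [1/2,0,0], vector [0,1/2,0], vector [0,-1/2,0], vector [0,0,1] :: real^3] ! i))"
    unfolding sph_eq_sin_sum by (simp add: scaleR_sum_right fun_eq_iff mult_ac)
  then show ?thesis by (simp only: Ck_on_sin_sum)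
qed

lemma has_derivative_sph:
  "((\<lambda>u. r *\<^sub>R sph u) has_derivative (\<lambda>v. r *\<^sub>R (v$1 *\<^sub>R sph_tangent 1 u + v$2 *\<^sub>R sph_tangent 2 u))) (at u)"
  unfolding sph_def sph_tangent_def vector_3_expand
  by (auto intro!: derivative_eq_intros bounded_linear_imp_has_derivative[OF bounded_linear_vec_nth]
      simp: algebra_simps)

text \<open>The open box omits the pole, where the immersion degenerates, the seam at azimuth 0, and
  the equator, where the surface meets the boundary of M.\<close>

definition hemisphere_domain :: "(real^2) set" where
  "hemisphere_domain = box (vector [0, 0]) (vector [pi/2, 2 * pi])"

lemma mem_hemisphere_domain:
  "u \<in> hemisphere_domain \<longleftrightarrow> 0 < u$1 \<and> u$1 < pi/2 \<and> 0 < u$2 \<and> u$2 < 2 * pi"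
  by (auto simp: hemisphere_domain_def mem_box_cart forall_2)

lemma inj_on_sph: "r > 0 \<Longrightarrow> inj_on (\<lambda>u. r *\<^sub>R sph u) hemisphere_domain"
proof (rule inj_onI)
  fix u v assume r: "r > 0" and u: "u \<in> hemisphere_domain" and v: "v \<in> hemisphere_domain"
    and eq: "r *\<^sub>R sph u = r *\<^sub>R sph v"
  then have eq': "sin (u$1) * cos (u$2) = sin (v$1) * cos (v$2)" "sin (u$1) * sin (u$2) = sin (v$1) * sin (v$2)"
    "cos (u$1) = cos (v$1)"
    by (auto simp: sph_def vec_eq_iff forall_3)
  note m = u[unfolded mem_hemisphere_domain] v[unfolded mem_hemisphere_domain]
  have 1: "u$1 = v$1" using eq'(3) m by (intro cos_inj_pi[of "u$1" "v$1"]) auto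
  have "sin (v$1) > 0" using m by (intro sin_gt_zero) auto
  then have "cos (u$2) = cos (v$2)" "sin (u$2) = sin (v$2)" using eq' 1 by auto
  then obtain n :: int where n: "u$2 = v$2 + 2 * pi * n" using sin_cos_eq_iff[of "u$2" "v$2"] by auto
  have "\<bar>2 * pi * n\<bar> < 2 * pi" using n m by auto
  then have "\<bar>real_of_int n\<bar> < 1" by (simp add: abs_mult)
  then have "n = 0" by linarith
  then show "u = v" using 1 n by (simp add: vec_eq_iff forall_2)
qed

lemma inj_frechet_derivative_sph:
  assumes "r > 0" "u \<in> hemisphere_domain"
  shows "inj (frechet_derivative (\<lambda>u. r *\<^sub>R sph u) (at u))"
proof -
  let ?L = "\<lambda>v::real^2. r *\<^sub>R (v$1 *\<^sub>R sph_tangent 1 u + v$2 *\<^sub>R sph_tangent 2 u)"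
  have s: "sin (u$1) > 0" using assms by (intro sin_gt_zero) (auto simp: mem_hemisphere_domain)
  have n: "sph u \<noteq> 0" using norm_sph[of u] by auto
  have "v = 0" if "?L v = 0" for v :: "real^2"
  proof -
    have 0: "v$1 *\<^sub>R sph_tangent 1 u + v$2 *\<^sub>R sph_tangent 2 u = 0" using that assms by simp
    \<comment> \<open>The cross product of the vanishing combination with one tangent vector
      isolates the coefficient of the other.\<close>
    have "cross3 (v$1 *\<^sub>R sph_tangent 1 u + v$2 *\<^sub>R sph_tangent 2 u) (sph_tangent 2 u) = v$1 *\<^sub>R (sin (u$1) *\<^sub>R sph u)"
      by (simp add: cross_add_left cross_mult_left cross_sph_tangent)
    moreover have "cross3 (sph_tangent 1 u) (v$1 *\<^sub>R sph_tangent 1 u + v$2 *\<^sub>R sph_tangent 2 u) = v$2 *\<^sub>R (sin (u$1) *\<^sub>R sph u)"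
      by (simp add: cross_add_right cross_mult_right cross_sph_tangent)
    ultimately have "v$1 = 0" "v$2 = 0" unfolding 0 using s n by auto
    then show "v = 0" by (simp add: vec_eq_iff forall_2)
  qed
  moreover have "linear ?L" using has_derivative_sph[of r u] by (rule has_derivative_linear)
  ultimately have "inj ?L" by (simp add: linear_injective_0)
  then show ?thesis using frechet_derivative_at[OF has_derivative_sph[of r u]] by simp
qed

lemma C1_differentiable_sph_curve:
  "(\<lambda>t. r *\<^sub>R sph (vector [a * t + c, b * t + d])) C1_differentiable_on {0..1}"
  unfolding C1_differentiable_on_def
proof (intro exI conjI ballI)
  fix t :: real
  show "((\<lambda>t. r *\<^sub>R sph (vector [a * t + c, b * t + d])) has_vector_derivative
     r *\<^sub>R (a *\<^sub>R sph_tangent 1 (vector [a * t + c, b * t + d]) + b *\<^sub>R sph_tangent 2 (vector [a * t + c, b * t + d]))) (at t)"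
    unfolding sph_def sph_tangent_def vector_3_expand has_vector_derivative_def
    by (auto intro!: derivative_eq_intros simp: algebra_simps)
  show "continuous_on {0..1} (\<lambda>t. r *\<^sub>R (a *\<^sub>R sph_tangent 1 (vector [a * t + c, b * t + d]) + b *\<^sub>R sph_tangent 2 (vector [a * t + c, b * t + d])))"
    unfolding sph_tangent_def vector_3_expand by (auto intro!: continuous_intros)
qed

lemma hemisphere_polar:
  assumes r: "r > 0" and v: "v $ 3 \<ge> 0" "(v $ 1)\<^sup>2 + (v $ 2)\<^sup>2 + (v $ 3)\<^sup>2 = r\<^sup>2"
  obtains \<theta> t where "0 \<le> \<theta>" "\<theta> \<le> pi/2" "0 \<le> t" "t < 2 * pi" "v = r *\<^sub>R sph (vector [\<theta>, t])"
proof -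
  have "(v $ 3)\<^sup>2 \<le> r\<^sup>2" using v(2) zero_le_power2[of "v $ 1"] zero_le_power2[of "v $ 2"] by linarith
  then have "v $ 3 \<le> r" by (rule power2_le_imp_le) (use r in simp)
  define z where "z = v $ 3 / r"
  have z: "0 \<le> z" "z \<le> 1" "v $ 3 = r * z" using v r \<open>v $ 3 \<le> r\<close> by (auto simp: z_def)
  define \<theta> where "\<theta> = arccos z"
  have th: "0 \<le> \<theta>" "\<theta> \<le> pi/2" "cos \<theta> = z"
    using z arccos_bounded[of z] arccos_le_pi2[of z] by (auto simp: \<theta>_def)
  then have "sin \<theta> \<ge> 0" by (intro sin_ge_zero) auto
  have h: "(v $ 1)\<^sup>2 + (v $ 2)\<^sup>2 = (r * sin \<theta>)\<^sup>2"
    using v(2) by (simp add: z(3) power_mult_distrib sin_squared_eq th(3) algebra_simps)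
  have "\<exists>t. 0 \<le> t \<and> t < 2 * pi \<and> v $ 1 = r * sin \<theta> * cos t \<and> v $ 2 = r * sin \<theta> * sin t"
  proof (cases "sin \<theta> = 0")
    case True
    then have "v $ 1 = 0" "v $ 2 = 0" using h by (auto simp: sum_power2_eq_zero_iff)
    \<comment> \<open>At the pole the azimuth is arbitrary; 0 is chosen.\<close>
    then show ?thesis using True by (intro exI[of _ 0]) auto
  next
    case False
    define s where "s = r * sin \<theta>"
    have s: "s \<noteq> 0" using False r by (simp add: s_def)
    have "(v $ 1 / s)\<^sup>2 + (v $ 2 / s)\<^sup>2 = 1"
      using h s by (simp add: power_divide s_def flip: add_divide_distrib)
    from sincos_total_2pi[OF this] obtain t where "0 \<le> t" "t < 2 * pi" "v $ 1 / s = cos t" "v $ 2 / s = sin t" .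
    then show ?thesis using s by (intro exI[of _ t]) (auto simp: s_def field_simps)
  qed
  then obtain t where "0 \<le> t" "t < 2 * pi" "v $ 1 = r * sin \<theta> * cos t" "v $ 2 = r * sin \<theta> * sin t" by blast
  then show ?thesis
    using that[OF th(1,2), of t] z(3) th(3) by (simp add: sph_def vec_eq_iff forall_3 mult.assoc)
qed

lemma parametrizes_hemisphere:
  assumes "r > 0"
  shows "parametrizes hemisphere_domain (\<lambda>u. r *\<^sub>R sph u)
    {v. v $ 3 \<ge> 0 \<and> (v $ 1)\<^sup>2 + (v $ 2)\<^sup>2 + (v $ 3)\<^sup>2 = r\<^sup>2}"
  unfolding parametrizes_def
proof (intro conjI)
  let ?X = "\<lambda>u. r *\<^sub>R sph u"
  let ?S = "{v. v $ 3 \<ge> 0 \<and> (v $ 1)\<^sup>2 + (v $ 2)\<^sup>2 + (v $ 3)\<^sup>2 = r\<^sup>2}"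
  show "open hemisphere_domain" by (simp add: hemisphere_domain_def open_box)
  show "smooth_on ?X hemisphere_domain"
    unfolding smooth_on_def
    by (intro ballI exI[of _ UNIV] exI[of _ ?X]) (simp add: Ck_on_sph)
  show "inj_on ?X hemisphere_domain" using inj_on_sph[OF assms] .
  show "\<forall>u\<in>hemisphere_domain. inj (frechet_derivative ?X (at u))"
    using inj_frechet_derivative_sph[OF assms] by blast
  have sq: "(r *\<^sub>R sph u) \<bullet> (r *\<^sub>R sph u) = r\<^sup>2" for u
    by (simp add: dot_square_norm norm_sph)
  show "?X ` hemisphere_domain \<subseteq> ?S"
  proof clarify
    fix u assume u: "u \<in> hemisphere_domain"
    then have "cos (u$1) \<ge> 0" by (intro cos_ge_zero) (auto simp: mem_hemisphere_domain)
    then show "(r *\<^sub>R sph u) $ 3 \<ge> 0 \<and> ((r *\<^sub>R sph u) $ 1)\<^sup>2 + ((r *\<^sub>R sph u) $ 2)\<^sup>2 + ((r *\<^sub>R sph u) $ 3)\<^sup>2 = r\<^sup>2"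
      using sq[of u] assms by (simp add: inner_vec_def sum_3 power2_eq_square) (simp add: sph_def)
  qed
  \<comment> \<open>\<open>p1\<close> is the meridian of azimuth 0, including the pole, and
    \<open>p2\<close> is the equator: together they cover what the open domain misses. The trivial
    summands keep the affine form of \<open>C1_differentiable_sph_curve\<close>.\<close>
  define p1 where "p1 = (\<lambda>t. r *\<^sub>R sph (vector [pi/2 * t + 0, 0 * t + 0]))"
  define p2 where "p2 = (\<lambda>t. r *\<^sub>R sph (vector [0 * t + pi/2, 2 * pi * t + 0]))"
  have "?S - ?X ` hemisphere_domain \<subseteq> (\<Union>p\<in>{p1, p2}. p ` {0..1})"
  proof clarify
    fix v assume v: "v $ 3 \<ge> 0" "(v $ 1)\<^sup>2 + (v $ 2)\<^sup>2 + (v $ 3)\<^sup>2 = r\<^sup>2"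
      and not_in: "v \<notin> ?X ` hemisphere_domain"
    obtain \<theta> t where t: "0 \<le> \<theta>" "\<theta> \<le> pi/2" "0 \<le> t" "t < 2 * pi" and veq: "v = r *\<^sub>R sph (vector [\<theta>, t])"
      using hemisphere_polar[OF assms v] .
    have "vector [\<theta>, t] \<notin> hemisphere_domain" using not_in veq by blast
    then have "\<theta> = 0 \<or> \<theta> = pi/2 \<or> t = 0" using t by (auto simp: mem_hemisphere_domain)
    then show "v \<in> (\<Union>p\<in>{p1, p2}. p ` {0..1})"
    proof (elim disjE)
      assume "\<theta> = 0"
      then have "v = p1 0" by (simp add: veq p1_def sph_def)
      then show ?thesis by auto
    next
      assume "\<theta> = pi/2"
      from this have "v = p2 (t / (2 * pi))" unfolding veq p2_def \<open>\<theta> = pi/2\<close> by simp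
      moreover have "t / (2 * pi) \<in> {0..1}" using t by auto
      ultimately show ?thesis by blast
    next
      assume "t = 0"
      then have "v = p1 (\<theta> / (pi/2))" by (simp add: veq p1_def)
      moreover have "\<theta> / (pi/2) \<in> {0..1}" using t by auto
      ultimately show ?thesis by blast
    qed
  qed
  moreover have "\<forall>p\<in>{p1, p2}. p C1_differentiable_on {0..1}"
    using C1_differentiable_sph_curve[of r "pi/2" 0 0 0] C1_differentiable_sph_curve[of r 0 "pi/2" "2 * pi" 0]
    by (auto simp: p1_def p2_def)
  ultimately show "\<exists>P. finite P \<and> (\<forall>p\<in>P. p C1_differentiable_on {0..1}) \<and>
    ?S - ?X ` hemisphere_domain \<subseteq> (\<Union>p\<in>P. p ` {0..1})"
    by (intro exI[of _ "{p1, p2}"]) simp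
qed

section \<open>Expansion of the Willmore density\<close>

text \<open>Christoffel symbols of the extension: two-sided derivatives, and the inverse matrix by
  Cramer's rule, so that expansion and continuity reduce to sums, products and one inverse.\<close>

definition christoffel_of :: "(real^3 \<Rightarrow> real^3^3) \<Rightarrow> 3 \<Rightarrow> 3 \<Rightarrow> 3 \<Rightarrow> real^3 \<Rightarrow> real" where
  "christoffel_of F k i j v = (1/2) * (\<Sum>l\<in>UNIV. inverse (det (F v)) * adj3 (F v) $ k $ l *
     (frechet_derivative F (at v) (axis i 1) $ j $ l + frechet_derivative F (at v) (axis j 1) $ i $ l
      - frechet_derivative F (at v) (axis l 1) $ i $ j))"

text \<open>This is the form B of \<open>willmore_density\<close> for the hemisphere, with \<kappa>
  = -1/r. At r = 0 it is the identity, as for a Euclidean sphere.\<close>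

definition curvature_matrix :: "(real^3 \<Rightarrow> real^3^3) \<Rightarrow> real \<Rightarrow> real^3 \<Rightarrow> real^3^3" where
  "curvature_matrix F r w = mat 1 - r *\<^sub>R (\<chi> a b. \<Sum>k\<in>UNIV. w $ k * christoffel_of F k a b (r *\<^sub>R w))"

text \<open>H^2 times the area density with the sine of the polar angle removed. The power -5/2 is
  split to suit \<open>expn_inverse\<close> and \<open>expn_sqrt\<close>.\<close>

definition hemisphere_density :: "(real^3 \<Rightarrow> real^3^3) \<Rightarrow> real \<Rightarrow> real^3 \<Rightarrow> real" where
  "hemisphere_density F r w =
     (polar_form (F (r *\<^sub>R w)) (curvature_matrix F r w) w)\<^sup>2 * det (F (r *\<^sub>R w)) *
     (inverse (adjoint_form (F (r *\<^sub>R w)) w))\<^sup>2 * inverse (sqrt (adjoint_form (F (r *\<^sub>R w)) w))"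

lemma expn_unit_vector:
  fixes w :: "'u \<Rightarrow> real^3"
  assumes "\<forall>u\<in>K. norm (w u) = 1"
  shows "expn K (\<lambda>r u. w u $ i) (\<lambda>u. w u $ i) (\<lambda>u. 0)"
proof (rule expn_0th[where C=1])
  fix u assume "u \<in> K"
  then show "\<bar>w u $ i\<bar> \<le> 1" using component_le_norm_cart[of "w u" i] assms by simp
qed

text \<open>The differential of the adjugate at c I is b -> c (tr b I - b). Besides c = 1 the value
  c = 2 is needed, because polarization evaluates the adjugate at a sum of two matrices near
  I.\<close>

lemma expn_adj3:
  fixes N :: "real \<Rightarrow> 'u \<Rightarrow> real^3^3"
  assumes N: "\<And>i j. expn K (\<lambda>r u. N r u $ i $ j) (\<lambda>u. c * mat 1 $ i $ j) (\<lambda>u. b u $ i $ j)"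
  shows "expn K (\<lambda>r u. adj3 (N r u) $ i $ j) (\<lambda>u. c\<^sup>2 * mat 1 $ i $ j)
    (\<lambda>u. c * (trace (b u) * mat 1 $ i $ j - b u $ i $ j))"
proof -
  have "\<forall>i j. expn K (\<lambda>r u. adj3 (N r u) $ i $ j) (\<lambda>u. c\<^sup>2 * mat 1 $ i $ j)
    (\<lambda>u. c * (trace (b u) * mat 1 $ i $ j - b u $ i $ j))"
    unfolding forall_3 adj3_def vector_3
    by (intro conjI; (rule expn_eq, (rule N expn_diff expn_mult)+))
      (simp_all add: mat_def trace_def sum_3 power2_eq_square algebra_simps)
  then show ?thesis by blast
qed

lemma expn_sum:
  assumes "finite I" "\<And>i. i \<in> I \<Longrightarrow> expn K (f i) (a i) (b i)"
  shows "expn K (\<lambda>r u. \<Sum>i\<in>I. f i r u) (\<lambda>u. \<Sum>i\<in>I. a i u) (\<lambda>u. \<Sum>i\<in>I. b i u)"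
  using assms
proof (induction I rule: finite_induct)
  case empty
  show ?case using expn_const[of K 0] by simp
next
  case (insert x I)
  then have "expn K (f x) (a x) (b x)" "expn K (\<lambda>r u. \<Sum>i\<in>I. f i r u) (\<lambda>u. \<Sum>i\<in>I. a i u) (\<lambda>u. \<Sum>i\<in>I. b i u)"
    by simp_all
  from expn_add[OF this] show ?case using insert.hyps by simp
qed

lemma expn_adjoint_form:
  fixes w :: "'u \<Rightarrow> real^3"
  assumes N: "\<And>i j. expn K (\<lambda>r u. N r u $ i $ j) (\<lambda>u. c * mat 1 $ i $ j) (\<lambda>u. b u $ i $ j)"
    and w: "\<forall>u\<in>K. norm (w u) = 1"
  shows "expn K (\<lambda>r u. adjoint_form (N r u) (w u)) (\<lambda>u. c\<^sup>2) (\<lambda>u. c * (trace (b u) - ip (b u) (w u) (w u)))"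
proof -
  note W = expn_unit_vector[OF w]
  have E: "adjoint_form M v = (\<Sum>i\<in>UNIV. \<Sum>j\<in>UNIV. adj3 M $ i $ j * v $ i * v $ j)" for M v
    by (simp add: adjoint_form_def ip_3)
  have ww: "w u \<bullet> w u = 1" if "u \<in> K" for u using bspec[OF w that] by (simp add: dot_square_norm)
  have e: "expn K (\<lambda>r u. adjoint_form (N r u) (w u)) (\<lambda>u. c\<^sup>2 * (w u \<bullet> w u))
     (\<lambda>u. c * (trace (b u) * (w u \<bullet> w u) - ip (b u) (w u) (w u)))"
    unfolding E
    by (rule expn_eq[OF expn_sum[OF finite expn_sum[OF finite expn_mult[OF expn_mult[OF expn_adj3[OF N] W] W]]]])
      (simp_all add: mat_def trace_def ip_3 inner_vec_def sum_3 algebra_simps power2_eq_square)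
  show ?thesis by (rule expn_eq[OF e]) (simp_all add: ww)
qed

lemma expn_det:
  fixes N :: "real \<Rightarrow> 'u \<Rightarrow> real^3^3"
  assumes N: "\<And>i j. expn K (\<lambda>r u. N r u $ i $ j) (\<lambda>u. mat 1 $ i $ j) (\<lambda>u. b u $ i $ j)"
  shows "expn K (\<lambda>r u. det (N r u)) (\<lambda>u. 1) (\<lambda>u. trace (b u))"
  unfolding det_3
  by (rule expn_eq, (rule N expn_add expn_diff expn_mult)+)
    (simp_all add: mat_def sum_3 trace_def algebra_simps)

text \<open>The first-order normal form at 0 of a map on a full neighbourhood; neither the
  half-space nor the Fermi condition appears from here on.\<close>

locale normalized_metric =
  fixes F :: "real^3 \<Rightarrow> real^3^3" and V :: "(real^3) set"
  assumes smooth: "\<And>k. Ck_on k F V" and V: "open V" "0 \<in> V"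
    and F0: "F 0 = mat 1"
    and tangential: "frechet_derivative F (at 0) (axis 1 1) = 0" "frechet_derivative F (at 0) (axis 2 1) = 0"
    and normal: "\<And>i. frechet_derivative F (at 0) (axis 3 1) $ i $ 3 = 0"
      "\<And>i. frechet_derivative F (at 0) (axis 3 1) $ 3 $ i = 0"
begin

abbreviation A :: "real^3^3" where "A \<equiv> frechet_derivative F (at 0) (axis 3 1)"

lemma has_derivative_F:
  assumes "v \<in> V" shows "(F has_derivative frechet_derivative F (at v)) (at v)"
  using Ck_on_Suc_D[OF smooth V(1) assms] .

lemma derivative_at_0: "frechet_derivative F (at 0) w = w $ 3 *\<^sub>R A"
proof -
  have l: "linear (frechet_derivative F (at 0))"
    using has_derivative_F[OF V(2)] by (rule has_derivative_linear)
  have "w = w $ 1 *\<^sub>R axis 1 1 + w $ 2 *\<^sub>R axis 2 1 + w $ 3 *\<^sub>R axis 3 1"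
    by (simp add: vec_eq_iff forall_3 axis_def)
  then have "frechet_derivative F (at 0) w =
    frechet_derivative F (at 0) (w $ 1 *\<^sub>R axis 1 1 + w $ 2 *\<^sub>R axis 2 1 + w $ 3 *\<^sub>R axis 3 1)" by simp
  also have "\<dots> = w $ 3 *\<^sub>R A"
    by (simp add: linear_add[OF l] linear_cmul[OF l] tangential)
  finally show ?thesis .
qed

lemma expn_F:
  assumes w: "\<forall>u\<in>K. norm (w u) = 1"
  shows "expn K (\<lambda>r u. F (r *\<^sub>R w u) $ i $ j) (\<lambda>u. mat 1 $ i $ j) (\<lambda>u. (w u $ 3 *\<^sub>R A) $ i $ j)"
  using expn_Ck_on[OF smooth V w, where e="axis i (axis j 1)"]
  by (simp add: inner_axis F0 derivative_at_0[of "w u" for u])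

text \<open>The coefficient of r stays existential: these derivatives enter the density only with a
  factor r, so that coefficient affects nothing below order r^2.\<close>

lemma expn_derivative:
  assumes w: "\<forall>u\<in>K. norm (w u) = 1"
  shows "\<exists>b. expn K (\<lambda>r u. frechet_derivative F (at (r *\<^sub>R w u)) v $ i $ j)
     (\<lambda>u. frechet_derivative F (at 0) v $ i $ j) b"
proof -
  have "Ck_on 2 (\<lambda>x. frechet_derivative F (at x) v) V"
    using smooth[of "Suc 2"] unfolding Ck_on.simps by blast
  from expn_Ck_on[OF this V w, where e="axis i (axis j 1)"] show ?thesis
    by (auto simp: inner_axis)
qed

lemma expn_christoffel:
  assumes w: "\<forall>u\<in>K. norm (w u) = 1"
  shows "\<exists>b. expn K (\<lambda>r u. christoffel_of F k i j (r *\<^sub>R w u))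
     (\<lambda>u. (1/2) * (frechet_derivative F (at 0) (axis i 1) $ j $ k + frechet_derivative F (at 0) (axis j 1) $ i $ k
      - frechet_derivative F (at 0) (axis k 1) $ i $ j)) b"
proof -
  \<comment> \<open>Names the unspecified coefficients for all indices at once, so that the
    expansion rules compose.\<close>
  define d where "d = (\<lambda>l i j. SOME b. expn K (\<lambda>r u. frechet_derivative F (at (r *\<^sub>R w u)) (axis l 1) $ i $ j)
     (\<lambda>u. frechet_derivative F (at 0) (axis l 1) $ i $ j) b)"
  have d: "expn K (\<lambda>r u. frechet_derivative F (at (r *\<^sub>R w u)) (axis l 1) $ i $ j)
     (\<lambda>u. frechet_derivative F (at 0) (axis l 1) $ i $ j) (d l i j)" for l i j
    unfolding d_def by (rule someI_ex[OF expn_derivative[OF w]])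
  note a = expn_adj3[where c=1, unfolded mult_1 one_power2, OF expn_F[OF w]]
  note D = expn_inverse[OF expn_det[OF expn_F[OF w]]]
  \<comment> \<open>At r = 0 the inverse determinant is 1 and the adjugate is I, so the sum over l
    collapses to l = k.\<close>
  show ?thesis
    unfolding christoffel_of_def
    by (rule exI, rule expn_eq[OF expn_cmult[OF expn_sum[OF finite
            expn_mult[OF expn_mult[OF D a] expn_diff[OF expn_add[OF d d] d]]]] _ refl])
      (simp add: mat_def if_distrib[of "\<lambda>x. x * _"] cong: if_cong)
qed

text \<open>The product rule with \<open>expn_r\<close>, whose constant term is 0, discards the
  unknown coefficients of the Christoffel symbols and keeps their values at 0.\<close>

lemma expn_curvature_matrix:
  assumes w: "\<forall>u\<in>K. norm (w u) = 1"
  shows "expn K (\<lambda>r u. curvature_matrix F r (w u) $ i $ j) (\<lambda>u. mat 1 $ i $ j)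
    (\<lambda>u. - (\<Sum>k\<in>UNIV. w u $ k * ((1/2) * (frechet_derivative F (at 0) (axis i 1) $ j $ k + frechet_derivative F (at 0) (axis j 1) $ i $ k
      - frechet_derivative F (at 0) (axis k 1) $ i $ j))))"
proof -
  define b where "b = (\<lambda>k. SOME b. expn K (\<lambda>r u. christoffel_of F k i j (r *\<^sub>R w u))
     (\<lambda>u. (1/2) * (frechet_derivative F (at 0) (axis i 1) $ j $ k + frechet_derivative F (at 0) (axis j 1) $ i $ k
      - frechet_derivative F (at 0) (axis k 1) $ i $ j)) b)"
  have b: "expn K (\<lambda>r u. christoffel_of F k i j (r *\<^sub>R w u))
     (\<lambda>u. (1/2) * (frechet_derivative F (at 0) (axis i 1) $ j $ k + frechet_derivative F (at 0) (axis j 1) $ i $ k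
      - frechet_derivative F (at 0) (axis k 1) $ i $ j)) (b k)" for k
    unfolding b_def by (rule someI_ex[OF expn_christoffel[OF w]])
  show ?thesis
    by (rule expn_cong[OF expn_diff[OF expn_const[where c="mat 1 $ i $ j"] expn_mult[OF expn_r expn_sum[OF finite_class.finite_UNIV expn_mult[OF expn_unit_vector[OF w] b]]]]])
      (simp_all add: curvature_matrix_def)
qed

lemma expn_hemisphere_density:
  assumes w: "\<forall>u\<in>K. norm (w u) = 1"
  shows "expn K (\<lambda>r u. hemisphere_density F r (w u)) (\<lambda>u. 4) (\<lambda>u. 8 * w u $ 3 * ip A (w u) (w u))"
    and "expn K (\<lambda>r u. adjoint_form (F (r *\<^sub>R w u)) (w u)) (\<lambda>u. 1) (\<lambda>u. w u $ 3 * (trace A - ip A (w u) (w u)))"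
    and "expn K (\<lambda>r u. det (F (r *\<^sub>R w u))) (\<lambda>u. 1) (\<lambda>u. w u $ 3 * trace A)"
proof -
  have ww: "(w u $ 3)\<^sup>2 = 1 - (w u $ 1)\<^sup>2 - (w u $ 2)\<^sup>2" if "u \<in> K" for u
    using bspec[OF w that] dot_square_norm[of "w u"] by (simp add: inner_vec_def sum_3 power2_eq_square)
  define \<beta> where "\<beta> = (\<lambda>u. \<chi> i j. - (\<Sum>k\<in>UNIV. w u $ k * ((1/2) * (frechet_derivative F (at 0) (axis i 1) $ j $ k + frechet_derivative F (at 0) (axis j 1) $ i $ k
      - frechet_derivative F (at 0) (axis k 1) $ i $ j))))"
  have B: "expn K (\<lambda>r u. curvature_matrix F r (w u) $ i $ j) (\<lambda>u. mat 1 $ i $ j) (\<lambda>u. \<beta> u $ i $ j)" for i j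
    using expn_curvature_matrix[OF w, where i=i and j=j] by (simp add: \<beta>_def)
  note M = expn_F[OF w]
  have MB: "expn K (\<lambda>r u. (F (r *\<^sub>R w u) + curvature_matrix F r (w u)) $ i $ j) (\<lambda>u. 2 * mat 1 $ i $ j)
     (\<lambda>u. (w u $ 3 *\<^sub>R A + \<beta> u) $ i $ j)" for i j
    by (rule expn_cong[OF expn_add[OF M B]]) simp_all
  have tr: "trace (w u $ 3 *\<^sub>R A) = w u $ 3 * trace A" for u
    by (simp add: trace_def sum_distrib_left)
  have E: "expn K (\<lambda>r u. adjoint_form (F (r *\<^sub>R w u)) (w u)) (\<lambda>u. 1) (\<lambda>u. w u $ 3 * (trace A - ip A (w u) (w u)))"
    by (rule expn_cong[OF expn_adjoint_form[where c=1, unfolded mult_1, OF M w]]) (simp_all add: tr ip_scaleR algebra_simps)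
  have \<Delta>: "expn K (\<lambda>r u. det (F (r *\<^sub>R w u))) (\<lambda>u. 1) (\<lambda>u. w u $ 3 * trace A)"
    by (rule expn_cong[OF expn_det[OF M]]) (simp_all add: tr)
  have EB: "expn K (\<lambda>r u. adjoint_form (curvature_matrix F r (w u)) (w u)) (\<lambda>u. 1) (\<lambda>u. trace (\<beta> u) - ip (\<beta> u) (w u) (w u))"
    by (rule expn_cong[OF expn_adjoint_form[where c=1, unfolded mult_1, OF B w]]) simp_all
  \<comment> \<open>Write y for \<open>w u $ 3\<close>. The tangential entries of \<beta> are y A /
    2. The mixed ones, -(A w) / 2, miss the trace but add -y A(w, w) to the quadratic form, which
    flips its sign.\<close>
  have tr\<beta>: "trace (\<beta> u) = w u $ 3 * trace A / 2" for u
    by (simp add: \<beta>_def trace_def sum_3 tangential normal algebra_simps)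
  have ip\<beta>: "ip (\<beta> u) (w u) (w u) = - w u $ 3 * ip A (w u) (w u) / 2" for u
    by (simp add: \<beta>_def ip_3 sum_3 tangential normal algebra_simps)
  \<comment> \<open>With t = tr A and a = A(w, w): the constant is 4 - 1 - 1 = 2, and the
    coefficient of r is y times (3 t - a) - (t - a) - (t + a) / 2.\<close>
  have Q: "expn K (\<lambda>r u. polar_form (F (r *\<^sub>R w u)) (curvature_matrix F r (w u)) (w u)) (\<lambda>u. 2)
     (\<lambda>u. w u $ 3 * (3/2 * trace A - 1/2 * ip A (w u) (w u)))"
    unfolding polar_form_def
    by (rule expn_cong[OF expn_diff[OF expn_diff[OF expn_adjoint_form[OF MB w] E] EB]])
      (simp_all add: tr trace_add ip_add ip_scaleR tr\<beta> ip\<beta> algebra_simps)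
  \<comment> \<open>Relative to the value 4, the square of the polar form contributes y (3 t - a) /
    2, the determinant y t, and the power -5/2 contributes -5 y (t - a) / 2. The traces cancel and 2
    y a remains.\<close>
  show "expn K (\<lambda>r u. hemisphere_density F r (w u)) (\<lambda>u. 4) (\<lambda>u. 8 * w u $ 3 * ip A (w u) (w u))"
    unfolding hemisphere_density_def power2_eq_square
    by (rule expn_cong[OF expn_mult[OF expn_mult[OF expn_mult[OF expn_mult[OF Q Q] \<Delta>]
          expn_mult[OF expn_inverse[OF E] expn_inverse[OF E]]] expn_inverse[OF expn_sqrt[OF E]]]])
      (simp_all add: field_simps)
  show "expn K (\<lambda>r u. adjoint_form (F (r *\<^sub>R w u)) (w u)) (\<lambda>u. 1) (\<lambda>u. w u $ 3 * (trace A - ip A (w u) (w u)))"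
    "expn K (\<lambda>r u. det (F (r *\<^sub>R w u))) (\<lambda>u. 1) (\<lambda>u. w u $ 3 * trace A)" by fact+
qed

end

section \<open>Fermi coordinates to first order\<close>

lemma has_vector_derivative_along_axis:
  assumes "(F has_derivative F') (at x)"
  shows "((\<lambda>t. F (x + t *\<^sub>R axis i 1)) has_vector_derivative F' (axis i (1::real))) (at 0)"
proof -
  have "((\<lambda>t. x + t *\<^sub>R axis i (1::real)) has_derivative (\<lambda>t. t *\<^sub>R axis i 1)) (at 0)"
    by (auto intro!: derivative_eq_intros)
  moreover have "(F has_derivative F') (at (x + 0 *\<^sub>R axis i 1))" using assms by simp
  ultimately have "((\<lambda>t. F (x + t *\<^sub>R axis i 1)) has_derivative (\<lambda>t. F' (t *\<^sub>R axis i 1))) (at 0)"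
    by (rule has_derivative_compose)
  then show ?thesis
    using linear_cmul[OF has_derivative_linear[OF assms]] by (simp add: has_vector_derivative_def)
qed

lemma has_derivative_entry:
  fixes F :: "'a::real_normed_vector \<Rightarrow> real^'n^'m"
  assumes "(F has_derivative F') (at x)"
  shows "((\<lambda>z. F z $ i $ j) has_derivative (\<lambda>v. F' v $ i $ j)) (at x)"
  by (intro bounded_linear.has_derivative[OF bounded_linear_vec_nth] assms)

text \<open>A line has constant velocity, so the geodesic equation reduces to its Christoffel term.
  The derivatives at 0 are one-sided but unique, since the interval is nondegenerate.\<close>

lemma geodesic_eq_at_line:
  fixes u :: "real \<Rightarrow> real^'n"
  assumes geo: "geodesic_eq_at S g {0..T} u 0" and T: "T > 0" and u: "\<And>t. t \<in> {0..T} \<Longrightarrow> u t = p + t *\<^sub>R d"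
  shows "(\<Sum>i\<in>UNIV. \<Sum>j\<in>UNIV. christoffel S g k i j p * d $ i * d $ j) = 0"
proof -
  define u' where "u' = (\<lambda>s. vector_derivative u (at s within {0..T}))"
  have u': "u' s = d" if s: "s \<in> {0..T}" for s
  proof -
    have "((\<lambda>t. p + t *\<^sub>R d) has_vector_derivative d) (at s within {0..T})"
      by (auto intro!: derivative_eq_intros simp: has_vector_derivative_def)
    then have "(u has_vector_derivative d) (at s within {0..T})"
      by (rule has_vector_derivative_transform[OF s u, rotated]) simp_all
    then show ?thesis unfolding u'_def using T s by (intro vector_derivative_within_closed_interval) auto
  qed
  define X where "X = (\<chi> k. - (\<Sum>i\<in>UNIV. \<Sum>j\<in>UNIV. christoffel S g k i j (u 0) * u' 0 $ i * u' 0 $ j))"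
  have "(u' has_vector_derivative X) (at 0 within {0..T})"
    using geo by (simp add: geodesic_eq_at_def Let_def X_def flip: u'_def)
  moreover have "(u' has_vector_derivative 0) (at 0 within {0..T})"
    by (rule has_vector_derivative_transform[of 0 _ u' "\<lambda>_. d"]) (use T u' in auto)
  ultimately have "X = 0"
    using T vector_derivative_unique_within_closed_interval[of 0 T 0 u' X 0] by simp
  then have "X $ k = 0" by simp
  then show ?thesis using u'[of 0] u[of 0] T by (simp add: X_def)
qed

lemma ip_axis: "ip M (axis i 1) (axis j 1) = M $ i $ j"
  by (simp add: ip_def inner_axis' matrix_vector_mult_basis column_def)

lemma bd_axis: "bd (axis i 1) = axis (if i = 1 then 1 else 2) 1"
  using exhaust_2[of i] by (auto simp: bd_def vec_eq_iff forall_3 axis_def)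

lemma bd_linear: "bd (t *\<^sub>R x) = t *\<^sub>R bd x" "bd (x + y) = bd x + bd y"
  by (simp_all add: bd_def vec_eq_iff forall_3)

lemma continuous_on_bd: "continuous_on X bd"
proof -
  have eq: "bd = (\<lambda>x. x $ 1 *\<^sub>R axis 1 1 + x $ 2 *\<^sub>R axis 2 1)"
    by (auto simp: bd_def vec_eq_iff forall_3 axis_def fun_eq_iff)
  show ?thesis unfolding eq by (intro continuous_intros)
qed

lemma norm_bd: "norm (bd x) = norm x"
  by (simp add: bd_def norm_vec_def L2_set_def sum_2 sum_3)

lemma mat_1_nth: "mat 1 $ i $ j = (if i = j then 1 else 0)"
  by (simp add: mat_def)

text \<open>The passage from one-sided to two-sided calculus: F extends the components g near 0, and
  its values are tied to g only on S.\<close>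

locale extended_metric =
  fixes S :: "(real^3) set" and g F :: "real^3 \<Rightarrow> real^3^3" and V :: "(real^3) set" and \<epsilon> :: real
  assumes \<epsilon>: "\<epsilon> > 0" "ball 0 \<epsilon> \<inter> half_space \<subseteq> S" "ball 0 \<epsilon> \<subseteq> V"
    and S: "openin (top_of_set half_space) S"
    and V: "open V" and smooth: "\<And>k. Ck_on k F V"
    and extends: "\<And>z. z \<in> V \<Longrightarrow> z \<in> S \<Longrightarrow> F z = g z"
    and sym: "\<And>z. z \<in> S \<Longrightarrow> transpose (g z) = g z"
begin

abbreviation D where "D v l \<equiv> frechet_derivative F (at v) (axis l 1)"

lemma has_derivative_F: "v \<in> V \<Longrightarrow> (F has_derivative frechet_derivative F (at v)) (at v)"
  using Ck_on_Suc_D[OF smooth V] .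

lemma S_half_space: "S \<subseteq> half_space"
  using openin_imp_subset[OF S] .

lemma half_ballD: "norm v < \<epsilon> \<Longrightarrow> v $ 3 \<ge> 0 \<Longrightarrow> v \<in> S" "norm v < \<epsilon> \<Longrightarrow> v \<in> V"
  "norm v < \<epsilon> \<Longrightarrow> v $ 3 \<ge> 0 \<Longrightarrow> F v = g v"
proof -
  show "norm v < \<epsilon> \<Longrightarrow> v $ 3 \<ge> 0 \<Longrightarrow> v \<in> S" "norm v < \<epsilon> \<Longrightarrow> v \<in> V"
    using \<epsilon> by (auto simp: half_space_def subset_iff)
  then show "norm v < \<epsilon> \<Longrightarrow> v $ 3 \<ge> 0 \<Longrightarrow> F v = g v"
    using extends by blast
qed

lemma partial_on_g:
  assumes v: "norm v < \<epsilon>" "v $ 3 \<ge> 0"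
  shows "partial_on S (\<lambda>z. g z $ i $ j) l v = D v l $ i $ j"
proof -
  let ?T = "{t. v + t *\<^sub>R axis l 1 \<in> S}"
  define \<delta> where "\<delta> = \<epsilon> - norm v"
  have d: "\<delta> > 0" using v by (simp add: \<delta>_def)
  have near: "norm (v + t *\<^sub>R axis l 1) < \<epsilon>" if "\<bar>t\<bar> < \<delta>" for t
    using norm_triangle_ineq[of v "t *\<^sub>R axis l 1"] that by (simp add: \<delta>_def norm_axis_1)
  \<comment> \<open>Positive steps along any axis keep the third coordinate nonnegative, even from
    boundary points; so 0 is a limit point of \<open>?T\<close> and the derivative within
    \<open>?T\<close> is unique.\<close>
  have "{0<..<\<delta>} \<subseteq> ?T"
    using near v by (auto intro!: half_ballD(1) simp: axis_def)
  then have "0 islimpt ?T"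
    using islimpt_greaterThanLessThan1[OF d] islimpt_subset by blast
  then have nb: "at 0 within ?T \<noteq> bot" by (simp add: trivial_limit_within)
  have "((\<lambda>t. F (v + t *\<^sub>R axis l 1) $ i $ j) has_vector_derivative D v l $ i $ j) (at 0 within ?T)"
    using has_vector_derivative_along_axis[OF has_derivative_entry[OF has_derivative_F[OF half_ballD(2)[OF v(1)]]]]
    by (rule has_vector_derivative_at_within)
  then have "((\<lambda>t. g (v + t *\<^sub>R axis l 1) $ i $ j) has_vector_derivative D v l $ i $ j) (at 0 within ?T)"
  proof (rule has_vector_derivative_transform_within[OF _ d])
    show "0 \<in> ?T" using v half_ballD(1) by simp
    fix t assume "t \<in> ?T" "dist t 0 < \<delta>"
    then show "F (v + t *\<^sub>R axis l 1) $ i $ j = g (v + t *\<^sub>R axis l 1) $ i $ j"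
      using near extends half_ballD(2) by simp
  qed
  then show ?thesis
    unfolding partial_on_def by (rule vector_derivative_within[OF nb])
qed

lemma christoffel_g:
  assumes v: "norm v < \<epsilon>" "v $ 3 \<ge> 0" and "det (F v) \<noteq> 0"
  shows "christoffel S g k i j v = christoffel_of F k i j v"
  using assms half_ballD(3)[OF v]
  by (simp add: christoffel_def christoffel_of_def partial_on_g matrix_inv_3)

text \<open>\<open>F\<close> is known to be symmetric only on S, so the symmetry is read off from
  the possibly one-sided derivatives of \<open>g\<close>.\<close>

lemma D_symmetric:
  assumes v: "norm v < \<epsilon>" "v $ 3 \<ge> 0"
  shows "D v l $ i $ j = D v l $ j $ i"
proof -
  have "g z $ i $ j = g z $ j $ i" if "z \<in> S" for z
    using arg_cong[OF sym[OF that], of "\<lambda>M. M $ i $ j"] by (simp add: transpose_def)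
  then have "partial_on S (\<lambda>z. g z $ i $ j) l v = partial_on S (\<lambda>z. g z $ j $ i) l v"
    using half_ballD(1)[OF v] by (intro partial_on_cong)
  then show ?thesis using v by (simp add: partial_on_g)
qed

lemma open_boundary: "open {x. bd x \<in> S}"
proof -
  from S obtain T where T: "open T" "S = half_space \<inter> T" by (auto simp: openin_open)
  then have "{x. bd x \<in> S} = bd -` T" by (auto simp: half_space_def bd_def)
  then show ?thesis using open_vimage[OF T(1) continuous_on_bd[of UNIV]] by simp
qed

lemma partial_on_bd_metric:
  "partial_on {x. bd x \<in> S} (\<lambda>z. bd_metric g z $ i $ j) l 0
     = D 0 (if l = 1 then 1 else 2) $ (if i = 1 then 1 else 2) $ (if j = 1 then 1 else 2)"
    (is "_ = D 0 ?l $ ?i $ ?j")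
proof (rule partial_on_eqI[OF open_boundary])
  show "0 \<in> {x. bd x \<in> S}" using half_ballD(1)[of 0] \<epsilon> bd_linear(1)[of 0 0] by simp
  have "((\<lambda>t. F (0 + t *\<^sub>R axis ?l 1) $ ?i $ ?j) has_vector_derivative D 0 ?l $ ?i $ ?j) (at 0)"
    using \<epsilon> by (intro has_vector_derivative_along_axis[OF has_derivative_entry[OF has_derivative_F[OF half_ballD(2)]]]) simp
  then show "((\<lambda>t. bd_metric g (0 + t *\<^sub>R axis l 1) $ i $ j) has_vector_derivative D 0 ?l $ ?i $ ?j) (at 0)"
  proof (rule has_vector_derivative_transform_within_open[of _ _ _ "ball 0 \<epsilon>"])
    fix t :: real assume "t \<in> ball 0 \<epsilon>"
    then have "norm (t *\<^sub>R axis ?l 1 :: real^3) < \<epsilon>" by (simp add: norm_axis_1)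
    moreover have "(t *\<^sub>R axis ?l 1 :: real^3) $ 3 \<ge> 0" by (simp add: axis_def)
    ultimately have "F (t *\<^sub>R axis ?l 1) = g (t *\<^sub>R axis ?l 1)"
      by (rule half_ballD(3))
    then show "F (0 + t *\<^sub>R axis ?l 1) $ ?i $ ?j = bd_metric g (0 + t *\<^sub>R axis l 1) $ i $ j"
      by (simp add: bd_metric_def bd_linear bd_axis ip_axis)
  qed (use \<epsilon> in auto)
qed

end

lemma inward_unit_normal_axis_3:
  assumes "inward_unit_normal M (axis 3 1)"
  shows "M $ 3 $ 1 = 0" "M $ 3 $ 2 = 0" "M $ 3 $ 3 = 1"
proof -
  have "ip M (axis 3 1) (axis 1 1) = 0" "ip M (axis 3 1) (axis 2 1) = 0" "ip M (axis 3 1) (axis 3 1) = 1"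
    using assms by (auto simp: inward_unit_normal_def axis_def)
  then show "M $ 3 $ 1 = 0" "M $ 3 $ 2 = 0" "M $ 3 $ 3 = 1" by (simp_all add: ip_axis)
qed

lemma inward_unit_normal_mat_1: "(THE n. inward_unit_normal (mat 1) n) = axis 3 1"
proof (rule the_equality)
  show "inward_unit_normal (mat 1) (axis 3 1)"
    by (simp add: inward_unit_normal_def ip_mat_1 inner_axis')
  fix n :: "real^3" assume n: "inward_unit_normal (mat 1) n"
  have "n \<bullet> axis 1 1 = 0" "n \<bullet> axis 2 1 = 0"
    using n by (simp_all add: inward_unit_normal_def ip_mat_1 axis_def)
  then have 0: "n $ 1 = 0" "n $ 2 = 0" by (simp_all add: inner_axis)
  have "n \<bullet> n = 1" "n $ 3 > 0" using n by (simp_all add: inward_unit_normal_def ip_mat_1)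
  then have "(n $ 3)\<^sup>2 = 1\<^sup>2" "n $ 3 > 0" using 0 by (simp_all add: inner_vec_def sum_3 power2_eq_square)
  then have "n $ 3 = 1" by (intro power2_eq_imp_eq[of "n $ 3" 1]) auto
  then show "n = axis 3 1" using 0 by (simp add: vec_eq_iff forall_3 axis_def)
qed

text \<open>Consequences of Fermi coordinates. The normal condition is kept along the boundary near
  0 because it gets differentiated tangentially; the geodesic equations are used at the origin
  only.\<close>

locale fermi_metric = extended_metric +
  assumes vertical_normal: "\<And>x. norm x < \<epsilon> \<Longrightarrow> inward_unit_normal (g (bd x)) (axis 3 1)"
    and vertical_geodesic: "\<And>k. christoffel S g k 3 3 0 = 0"
    and radial_geodesic: "\<And>x k. norm x < \<epsilon> \<Longrightarrow>
      (\<Sum>i\<in>UNIV. \<Sum>j\<in>UNIV. christoffel {x. bd x \<in> S} (bd_metric g) k i j 0 * x $ i * x $ j) = 0"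
    and frame: "g 0 $ 1 $ 1 = 1" "g 0 $ 2 $ 2 = 1" "g 0 $ 1 $ 2 = 0"
begin

lemma bd_0: "bd 0 = 0"
  using bd_linear(1)[of 0 0] by simp

lemma zero_in_S: "0 \<in> S"
  using half_ballD(1)[of 0] \<epsilon> by simp

lemma g_0: "g 0 = mat 1"
proof -
  have "g 0 $ 3 $ 1 = 0" "g 0 $ 3 $ 2 = 0" "g 0 $ 3 $ 3 = 1"
    using inward_unit_normal_axis_3[OF vertical_normal[of 0]] \<epsilon> by (simp_all add: bd_0)
  moreover have "g 0 $ i $ j = g 0 $ j $ i" for i j
    using arg_cong[OF sym[OF zero_in_S], of "\<lambda>M. M $ i $ j"] by (simp add: transpose_def)
  ultimately show ?thesis using frame by (simp add: vec_eq_iff forall_3 mat_def)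
qed

lemma F_0: "F 0 = mat 1"
  using half_ballD(3)[of 0] \<epsilon> g_0 by simp

lemma christoffel_0:
  "christoffel S g k i j 0 = (1/2) * (D 0 i $ j $ k + D 0 j $ i $ k - D 0 k $ i $ j)"
  using \<epsilon> exhaust_3[of k]
  by (auto simp: christoffel_def partial_on_g g_0 matrix_inv_mat_1 sum_3 mat_1_nth)

text \<open>By the normal condition the third row of the metric is that of the identity all along
  the boundary near 0, so its tangential derivatives vanish.\<close>

lemma D_vertical_row:
  assumes "l = 1 \<or> l = 2"
  shows "D 0 l $ 3 $ i = 0"
proof -
  obtain m :: 2 where m: "bd (axis m 1) = axis l 1" using assms bd_axis[of 1] bd_axis[of 2] by auto
  have "((\<lambda>t. F (0 + t *\<^sub>R axis l 1) $ 3 $ i) has_vector_derivative D 0 l $ 3 $ i) (at 0)"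
    using \<epsilon> by (intro has_vector_derivative_along_axis[OF has_derivative_entry[OF has_derivative_F[OF half_ballD(2)]]]) simp
  then have "((\<lambda>t. mat 1 $ 3 $ i) has_vector_derivative D 0 l $ 3 $ i) (at (0::real))"
  proof (rule has_vector_derivative_transform_within_open[of _ _ _ "ball 0 \<epsilon>"])
    fix t :: real assume t: "t \<in> ball 0 \<epsilon>"
    have v: "t *\<^sub>R axis l 1 = bd (t *\<^sub>R axis m 1)" by (simp add: bd_linear m)
    have n: "norm (t *\<^sub>R axis m (1::real)) < \<epsilon>" using t by (simp add: norm_axis_1)
    have "F (t *\<^sub>R axis l 1) = g (t *\<^sub>R axis l 1)"
      unfolding v using n by (intro half_ballD(3)) (simp_all only: norm_bd, simp add: bd_def)
    then show "F (0 + t *\<^sub>R axis l 1) $ 3 $ i = mat 1 $ 3 $ i"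
      using inward_unit_normal_axis_3[OF vertical_normal[OF n]] exhaust_3[of i]
      by (auto simp: v mat_def)
  qed (use \<epsilon> in auto)
  then show ?thesis
    using vector_derivative_unique_at[OF has_vector_derivative_const] by metis
qed

lemma D_symmetric_0: "D 0 l $ i $ j = D 0 l $ j $ i"
  using D_symmetric[of 0] \<epsilon> by simp

text \<open>The vertical geodesic gives 2 d_3 g_3k = d_k g_33 at 0. For tangential k the right side
  vanishes by \<open>D_vertical_row\<close>; for k = 3 the equation itself gives 0.\<close>

lemma D_vertical: "D 0 3 $ 3 $ i = 0"
proof -
  have "2 * D 0 3 $ 3 $ k - D 0 k $ 3 $ 3 = 0" for k
    using vertical_geodesic[of k] by (simp add: christoffel_0)
  from this[of 1] this[of 2] this[of 3] show ?thesis
    using D_vertical_row[of 1 3] D_vertical_row[of 2 3] exhaust_3[of i] by auto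
qed

text \<open>The radial geodesics make a quadratic form vanish for all small x; hence all Christoffel
  symbols of the boundary metric vanish at 0, and with them its first derivatives.\<close>

lemma D_tangential:
  assumes "l = 1 \<or> l = 2" "i = 1 \<or> i = 2" "j = 1 \<or> j = 2"
  shows "D 0 l $ i $ j = 0"
proof -
  let ?e = "\<lambda>i::2. if i = 1 then 1 else 2 :: 3"
  define d where "d = (\<lambda>l i j. D 0 (?e l) $ ?e i $ ?e j)"
  have "bd_metric g 0 = mat 1"
    by (simp add: bd_metric_def bd_0 g_0 bd_axis ip_axis vec_eq_iff forall_2 mat_def)
  then have \<Gamma>: "christoffel {x. bd x \<in> S} (bd_metric g) k i j 0 = (1/2) * (d i j k + d j i k - d k i j)" for k i j
    using exhaust_2[of k]
    by (auto simp: christoffel_def partial_on_bd_metric matrix_inv_mat_1 sum_2 mat_1_nth d_def)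
  have s: "d l i j = d l j i" for l i j by (simp add: d_def D_symmetric_0)
  have q: "(d 1 1 k - (1/2) * d k 1 1) * (x$1)\<^sup>2 + (d 1 2 k + d 2 1 k - d k 1 2) * (x$1 * x$2) +
      (d 2 2 k - (1/2) * d k 2 2) * (x$2)\<^sup>2 = 0" if "norm x < \<epsilon>" for x :: "real^2" and k
    using radial_geodesic[OF that, of k] s[of k 1 2]
    by (simp add: \<Gamma> sum_2 power2_eq_square algebra_simps)
  \<comment> \<open>Small enough that the sum of the two scaled axes, which detects the mixed
    coefficient, still lies in the ball.\<close>
  define \<delta> where "\<delta> = \<epsilon> / 3"
  have \<delta>: "\<delta> > 0" "\<delta> < \<epsilon>" "\<delta> + \<delta> < \<epsilon>" using \<epsilon> by (auto simp: \<delta>_def)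
  have n: "norm (\<delta> *\<^sub>R axis i (1::real)) = \<delta>" for i :: 2 using \<delta> by (simp add: norm_axis_1)
  have 1: "d 1 1 k - (1/2) * d k 1 1 = 0" for k
    using q[of "\<delta> *\<^sub>R axis 1 1" k] n[of 1] \<delta> by (simp add: axis_def)
  have 2: "d 2 2 k - (1/2) * d k 2 2 = 0" for k
    using q[of "\<delta> *\<^sub>R axis 2 1" k] n[of 2] \<delta> by (simp add: axis_def)
  have sm: "norm (\<delta> *\<^sub>R axis 1 (1::real) + \<delta> *\<^sub>R axis 2 1 :: real^2) < \<epsilon>"
    using norm_triangle_ineq[of "\<delta> *\<^sub>R axis 1 (1::real) :: real^2" "\<delta> *\<^sub>R axis 2 1"] n[of 1] n[of 2] \<delta> by linarith
  have 3: "d 1 2 k + d 2 1 k - d k 1 2 = 0" for k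
    using q[OF sm, of k, unfolded 1 2] \<delta> by (simp add: axis_def)
  \<comment> \<open>Six linear equations for the six derivatives of a symmetric 2x2 matrix, with
    only the zero solution.\<close>
  have z: "d l i j = 0" for l i j
    using 1[of 1] 1[of 2] 2[of 1] 2[of 2] 3[of 1] 3[of 2] s[of 1 1 2] s[of 2 1 2]
      exhaust_2[of l] exhaust_2[of i] exhaust_2[of j] by (elim disjE; simp)
  have e: "?e (if x = 1 then 1 else 2) = x" if "x = 1 \<or> x = 2" for x :: 3 using that by auto
  show ?thesis
    using z[of "if l = 1 then 1 else 2" "if i = 1 then 1 else 2" "if j = 1 then 1 else 2"]
    unfolding d_def e[OF assms(1)] e[OF assms(2)] e[OF assms(3)] .
qed

sublocale normalized_metric F V
proof
  have "D 0 l $ i $ j = 0" if "l = 1 \<or> l = 2" for l i j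
    using D_tangential[OF that, of i j] D_vertical_row[OF that] D_symmetric_0[of l i j] exhaust_3[of i] exhaust_3[of j]
    by auto
  then show "D 0 1 = 0" "D 0 2 = 0" by (simp_all add: vec_eq_iff)
  show "D 0 3 $ i $ 3 = 0" "D 0 3 $ 3 $ i = 0" for i
    using D_vertical[of i] D_symmetric_0[of 3 i 3] by auto
  show "0 \<in> V" using half_ballD(2)[of 0] \<epsilon> by simp
qed (use V smooth F_0 in auto)

text \<open>The inclusion \<open>bd\<close> is linear, so II_ij is just Gamma^3_ij = - d_3 g_ij / 2
  at 0. As A_33 = 0, the 2x2 trace equals the full trace of \<open>A\<close>.\<close>

lemma boundary_mean_curvature_0:
  "mean_curvature S g {x. bd x \<in> S} bd (THE n. inward_unit_normal (g 0) n) 0 = - trace A / 2"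
proof -
  let ?B = "{x. bd x \<in> S}"
  let ?e = "\<lambda>i::2. if i = 1 then 1 else 2 :: 3"
  have 0: "0 \<in> ?B" using zero_in_S by (simp add: bd_0)
  have P: "partial_on ?B bd i x = axis (?e i) 1" if "x \<in> ?B" for i x
  proof (rule partial_on_eqI[OF open_boundary that])
    have "((\<lambda>t. bd x + t *\<^sub>R bd (axis i 1)) has_vector_derivative bd (axis i 1)) (at 0)"
      by (auto intro!: derivative_eq_intros simp: has_vector_derivative_def)
    then show "((\<lambda>t. bd (x + t *\<^sub>R axis i 1)) has_vector_derivative axis (?e i) 1) (at 0)"
      by (simp add: bd_linear bd_axis)
  qed
  have "partial_on ?B (partial_on ?B bd j) i 0 = 0" for i j
  proof -
    have "partial_on ?B (partial_on ?B bd j) i 0 = partial_on ?B (\<lambda>_. axis (?e j) (1::real)) i 0"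
      by (rule partial_on_cong[OF 0 P])
    also have "\<dots> = 0" by (rule partial_on_eqI[OF open_boundary 0]) simp
    finally show ?thesis .
  qed
  then have "cov_deriv S g ?B bd i j 0 $ 3 = christoffel S g 3 (?e i) (?e j) 0" for i j
    using P[OF 0]
    by (simp add: cov_deriv_def bd_0 sum_3 axis_def)
  moreover have "D 0 (?e i) = 0" for i by (simp add: tangential)
  ultimately have "cov_deriv S g ?B bd i j 0 $ 3 = - A $ ?e i $ ?e j / 2" for i j
    by (simp only: christoffel_0 zero_index) simp
  then have "second_form S g ?B bd (axis 3 1) 0 $ i $ j = - A $ ?e i $ ?e j / 2" for i j
    by (simp only: second_form_def bd_0 g_0 ip_mat_1 vec_lambda_beta) (simp only: inner_axis, simp)
  moreover have "first_form g ?B bd 0 $ i $ j = mat 1 $ i $ j" for i j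
    using exhaust_2[of i] exhaust_2[of j] by (auto simp: first_form_def P[OF 0] bd_0 g_0 ip_axis mat_1_nth)
  then have "first_form g ?B bd 0 = mat 1" by (simp add: vec_eq_iff)
  ultimately show ?thesis
    using normal(1)[of 3] by (simp add: mean_curvature_def g_0 inward_unit_normal_mat_1 matrix_inv_mat_1 trace_def sum_2 sum_3)
qed

end

section \<open>Conditions extracted from a Fermi chart\<close>

context
  fixes A :: "'a::{t2_space, second_countable_topology} chart set"
    and G :: "'a chart \<Rightarrow> real^3 \<Rightarrow> real^3^3"
    and c :: "'a chart"
  assumes chart: "is_chart c"
begin

lemma snd_chart_inv: "x \<in> image_of c \<Longrightarrow> snd c (chart_inv c x) = x"
  using chart by (auto simp: is_chart_def homeomorphism_def)

lemma chart_inv_mem: "x \<in> image_of c \<Longrightarrow> chart_inv c x \<in> fst c"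
  using chart by (auto simp: is_chart_def homeomorphism_def)

lemma velocity_line:
  assumes "T > 0" "\<And>t. t \<in> {0..T} \<Longrightarrow> h t \<in> image_of c" "\<And>t. t \<in> {0..T} \<Longrightarrow> h t = p + t *\<^sub>R d"
  shows "velocity c (\<lambda>t. chart_inv c (h t)) {0..T} 0 = d"
proof -
  have "((\<lambda>t. p + t *\<^sub>R d) has_vector_derivative d) (at 0 within {0..T})"
    by (auto intro!: derivative_eq_intros simp: has_vector_derivative_def)
  then have "(snd c \<circ> (\<lambda>t. chart_inv c (h t)) has_vector_derivative d) (at 0 within {0..T})"
    by (rule has_vector_derivative_transform[rotated 2]) (use assms snd_chart_inv in auto)
  then show ?thesis
    unfolding velocity_def using assms(1) by (intro vector_derivative_within_closed_interval) auto
qed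

text \<open>The normal clause of \<open>fermi_chart\<close> speaks only of points of positive
  height, so it is applied to a point at height T above \<open>bd x\<close>, whose coordinate
  segment is a line with velocity \<open>axis 3 1\<close>.\<close>

lemma fermi_vertical:
  assumes fermi: "fermi_chart A G q c" and v: "bd x + T *\<^sub>R axis 3 1 \<in> image_of c" and T: "T > 0"
  shows "inward_unit_normal (G c (bd x)) (axis 3 1)"
    and "(\<Sum>i\<in>UNIV. \<Sum>j\<in>UNIV. christoffel (image_of c) (G c) k i j (bd x) * axis 3 1 $ i * axis 3 1 $ j) = 0"
proof -
  let ?v = "bd x + T *\<^sub>R axis 3 1 :: real^3"
  define h where "h = (\<lambda>t. vector [?v $ 1, ?v $ 2, t] :: real^3)"
  define \<gamma> where "\<gamma> = (\<lambda>t. chart_inv c (h t))"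
  have v3: "?v $ 3 = T" by (simp add: bd_def)
  have h: "h t = bd x + t *\<^sub>R axis 3 1" for t
    by (simp add: h_def bd_def vec_eq_iff forall_3 axis_def)
  have cA: "c \<in> A" using fermi by (simp add: fermi_chart_def)
  have "\<forall>v\<in>image_of c. v $ 3 > 0 \<longrightarrow>
        (\<forall>t\<in>{0..v $ 3}. vector [v $ 1, v $ 2, t] \<in> image_of c) \<and>
        geodesic A G (\<lambda>t. chart_inv c (vector [v $ 1, v $ 2, t])) {0..v $ 3} \<and>
        inward_unit_normal (G c (snd c (chart_inv c (vector [v $ 1, v $ 2, 0]))))
          (velocity c (\<lambda>t. chart_inv c (vector [v $ 1, v $ 2, t])) {0..v $ 3} 0)"
    using fermi unfolding fermi_chart_def Let_def by (elim conjE)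
  from this[rule_format, OF v, unfolded v3, OF T] have f: "\<forall>t\<in>{0..T}. h t \<in> image_of c" "geodesic A G \<gamma> {0..T}"
    "inward_unit_normal (G c (snd c (\<gamma> 0))) (velocity c \<gamma> {0..T} 0)"
    unfolding h_def \<gamma>_def by blast+
  have "velocity c \<gamma> {0..T} 0 = axis 3 1"
    unfolding \<gamma>_def by (rule velocity_line[OF T]) (use f h in auto)
  moreover have im: "bd x \<in> image_of c" using bspec[OF f(1), of 0] T by (simp add: h)
  then have "snd c (\<gamma> 0) = bd x" by (simp add: \<gamma>_def h snd_chart_inv)
  ultimately show "inward_unit_normal (G c (bd x)) (axis 3 1)" using f(3) by simp
  have "\<gamma> 0 \<in> fst c" using im chart_inv_mem by (simp add: \<gamma>_def h)
  then have "geodesic_eq_at (image_of c) (G c) {0..T} (snd c \<circ> \<gamma>) 0"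
    using f(2) cA T by (auto simp: geodesic_def)
  then show "(\<Sum>i\<in>UNIV. \<Sum>j\<in>UNIV. christoffel (image_of c) (G c) k i j (bd x) * axis 3 1 $ i * axis 3 1 $ j) = 0"
    by (rule geodesic_eq_at_line[OF _ T]) (use f(1) snd_chart_inv h in \<open>auto simp: \<gamma>_def\<close>)
qed

lemma fermi_radial:
  assumes fermi: "fermi_chart A G q c" and x: "x \<in> bd_image c"
  shows "(\<Sum>i\<in>UNIV. \<Sum>j\<in>UNIV. christoffel (bd_image c) (bd_metric (G c)) k i j 0 * x $ i * x $ j) = 0"
proof -
  define \<gamma> where "\<gamma> = (\<lambda>t. chart_inv c (bd (t *\<^sub>R x)))"
  have f: "\<forall>t\<in>{0..1}. t *\<^sub>R x \<in> bd_image c" "boundary_geodesic A G \<gamma> {0..1}" and cA: "c \<in> A"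
    using fermi x unfolding fermi_chart_def Let_def \<gamma>_def by blast+
  have im: "bd (t *\<^sub>R x) \<in> image_of c" if "t \<in> {0..1}" for t
    using f(1) that by (auto simp: bd_image_def)
  have "\<gamma> 0 \<in> fst c" using im[of 0] chart_inv_mem by (simp add: \<gamma>_def)
  then have "geodesic_eq_at (bd_image c) (bd_metric (G c)) {0..1} (bd_proj \<circ> snd c \<circ> \<gamma>) 0"
    using f(2) cA by (auto simp: boundary_geodesic_def)
  then show ?thesis
  proof (rule geodesic_eq_at_line)
    fix t :: real assume "t \<in> {0..1}"
    then show "(bd_proj \<circ> snd c \<circ> \<gamma>) t = 0 + t *\<^sub>R x"
      using im snd_chart_inv by (simp add: \<gamma>_def bd_proj_def bd_def vec_eq_iff forall_2)
  qed simp
qed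

text \<open>In coordinates the radial curve towards x has initial velocity \<open>bd x\<close>.
  Comparison with the prescribed velocity forces e1 and e2 to be the first two axes, and their
  orthonormality becomes a statement about entries of the metric.\<close>

lemma fermi_frame:
  assumes fermi: "fermi_chart A G q c" and r: "r > 0" "\<And>x. norm x \<le> r \<Longrightarrow> x \<in> bd_image c"
  shows "G c 0 $ 1 $ 1 = 1" "G c 0 $ 2 $ 2 = 1" "G c 0 $ 1 $ 2 = 0"
proof -
  obtain e1 e2 where ip: "ip (G c 0) e1 e1 = 1" "ip (G c 0) e2 e2 = 1" "ip (G c 0) e1 e2 = 0"
    and e: "\<And>x. x \<in> bd_image c \<Longrightarrow> (\<forall>t\<in>{0..1}. t *\<^sub>R x \<in> bd_image c) \<and>
       velocity c (\<lambda>t. chart_inv c (bd (t *\<^sub>R x))) {0..1} 0 = x $ 1 *\<^sub>R e1 + x $ 2 *\<^sub>R e2"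
    using fermi unfolding fermi_chart_def Let_def by blast
  have frame: "bd x = x $ 1 *\<^sub>R e1 + x $ 2 *\<^sub>R e2" if "norm x \<le> r" for x
  proof -
    have "velocity c (\<lambda>t. chart_inv c (bd (t *\<^sub>R x))) {0..1} 0 = bd x"
      by (rule velocity_line[where p=0]) (use e[OF r(2)[OF that]] in \<open>auto simp: bd_image_def bd_linear\<close>)
    then show ?thesis using e[OF r(2)[OF that]] by simp
  qed
  have "norm (r *\<^sub>R axis i (1::real) :: real^2) \<le> r" for i using r(1) by (simp add: norm_axis_1)
  from frame[OF this[of 1]] frame[OF this[of 2]] have "e1 = axis 1 1" "e2 = axis 2 1"
    using r(1) by (simp_all add: bd_linear bd_axis) (simp_all add: axis_def)
  then show "G c 0 $ 1 $ 1 = 1" "G c 0 $ 2 $ 2 = 1" "G c 0 $ 1 $ 2 = 0"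
    using ip by (simp_all add: ip_axis)
qed

lemma fermi_metric_extension:
  assumes fermi: "fermi_chart A G q c" and smooth: "smooth_on (G c) (image_of c)"
    and sym: "\<And>x. x \<in> image_of c \<Longrightarrow> transpose (G c x) = G c x"
  obtains F V \<epsilon> where "fermi_metric (image_of c) (G c) F V \<epsilon>"
proof -
  let ?S = "image_of c"
  have "0 \<in> ?S" using fermi by (auto simp: fermi_chart_def image_of_def)
  then obtain V F where V: "open V" "0 \<in> V" and F: "\<And>k. Ck_on k F V" "\<forall>z\<in>V \<inter> ?S. F z = G c z"
    using smooth unfolding smooth_on_def by blast
  have op: "openin (top_of_set half_space) ?S" using chart by (simp add: is_chart_def)
  then obtain T where T: "open T" "?S = half_space \<inter> T" by (auto simp: openin_open)
  have "open (V \<inter> T)" "0 \<in> V \<inter> T" using V T \<open>0 \<in> ?S\<close> by auto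
  then obtain \<epsilon> where \<epsilon>: "\<epsilon> > 0" "ball 0 \<epsilon> \<subseteq> V \<inter> T" using open_contains_ball by blast
  interpret extended_metric ?S "G c" F V \<epsilon>
  proof
    show "\<epsilon> > 0" "ball 0 \<epsilon> \<inter> half_space \<subseteq> ?S" "ball 0 \<epsilon> \<subseteq> V" using \<epsilon> T(2) by auto
    show "F z = G c z" if "z \<in> V" "z \<in> ?S" for z using F(2) that by simp
  qed (fact op V(1) F(1) sym)+
  have bd_im: "x \<in> bd_image c" if "norm x < \<epsilon>" for x
    using half_ballD(1)[of "bd x"] that by (simp add: bd_image_def norm_bd) (simp add: bd_def)
  have vert: "\<exists>t>0. bd x + t *\<^sub>R axis 3 1 \<in> ?S" if "norm x < \<epsilon>" for x
  proof (intro exI conjI)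
    \<comment> \<open>Half the remaining distance keeps the raised point inside the ball.\<close>
    let ?t = "(\<epsilon> - norm x) / 2"
    show "?t > 0" using that by simp
    have "norm (bd x + ?t *\<^sub>R axis 3 1) \<le> norm x + ?t"
      using norm_triangle_ineq[of "bd x" "?t *\<^sub>R axis 3 1"] that by (simp add: norm_bd norm_axis_1)
    also have "\<dots> < \<epsilon>" using that by (simp add: field_simps)
    finally show "bd x + ?t *\<^sub>R axis 3 1 \<in> ?S" using that by (intro half_ballD(1)) (auto simp: bd_def)
  qed
  have "fermi_metric ?S (G c) F V \<epsilon>"
  proof unfold_locales
    fix x :: "real^2" and k :: 2
    assume x: "norm x < \<epsilon>"
    show "inward_unit_normal (G c (bd x)) (axis 3 1)"
      using vert[OF x] fermi_vertical(1)[OF fermi] by blast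
    show "(\<Sum>i\<in>UNIV. \<Sum>j\<in>UNIV. christoffel {x. bd x \<in> ?S} (bd_metric (G c)) k i j 0 * x $ i * x $ j) = 0"
      using fermi_radial[OF fermi bd_im[OF x]] by (simp add: bd_image_def)
  next
    fix k :: 3
    obtain t where "t > 0" "bd 0 + t *\<^sub>R axis 3 1 \<in> ?S" using vert[of 0] \<epsilon> by auto
    from fermi_vertical(2)[OF fermi this(2,1), of k] show "christoffel ?S (G c) k 3 3 0 = 0"
      using bd_linear(1)[of 0 0] by (simp add: sum_3 axis_def)
  next
    show "G c 0 $ 1 $ 1 = 1" "G c 0 $ 2 $ 2 = 1" "G c 0 $ 1 $ 2 = 0"
      using fermi_frame[OF fermi, of "\<epsilon> / 2"] bd_im \<epsilon>(1) by auto
  qed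
  then show ?thesis using that by blast
qed

end

section \<open>Continuity of the density in the parameters\<close>

lemma continuous_on_adj3:
  assumes "\<And>i j. continuous_on K (\<lambda>u. N u $ i $ j)"
  shows "continuous_on K (\<lambda>u. adj3 (N u) $ i $ j)"
proof -
  have "\<forall>i j. continuous_on K (\<lambda>u. adj3 (N u) $ i $ j)"
    unfolding forall_3 adj3_def vector_3 by (intro conjI; (rule assms continuous_on_diff continuous_on_mult)+)
  then show ?thesis by blast
qed

lemma continuous_on_adjoint_form:
  assumes "\<And>i j. continuous_on K (\<lambda>u. N u $ i $ j)" "continuous_on K w"
  shows "continuous_on K (\<lambda>u. adjoint_form (N u) (w u))"
  unfolding adjoint_form_def ip_3
  by (rule continuous_on_sum continuous_on_mult continuous_on_adj3 assms continuous_on_component)+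

lemma continuous_on_det_3:
  fixes N :: "'a::topological_space \<Rightarrow> real^3^3"
  assumes "\<And>i j. continuous_on K (\<lambda>u. N u $ i $ j)"
  shows "continuous_on K (\<lambda>u. det (N u))"
  unfolding det_3 by (rule assms continuous_on_add continuous_on_diff continuous_on_mult)+

lemma continuous_on_sph: "continuous_on K sph"
  using Ck_on_imp_continuous_on[OF Ck_on_sph[of 0 1]] by simp

context normalized_metric
begin

lemma continuous_on_hemisphere_density:
  assumes r: "\<And>u. r *\<^sub>R sph u \<in> V" and pos: "\<And>u. det (F (r *\<^sub>R sph u)) > 0" "\<And>u. adjoint_form (F (r *\<^sub>R sph u)) (sph u) > 0"
  shows "continuous_on K (\<lambda>u. hemisphere_density F r (sph u))"
proof -
  have nz: "det (F (r *\<^sub>R sph u)) \<noteq> 0" "adjoint_form (F (r *\<^sub>R sph u)) (sph u) \<noteq> 0" for u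
    using pos[of u] by simp_all
  have s: "continuous_on K (\<lambda>u. r *\<^sub>R sph u)" by (intro continuous_intros continuous_on_sph)
  have F: "continuous_on K (\<lambda>u. F (r *\<^sub>R sph u) $ i $ j)" for i j
    using continuous_on_compose2[OF Ck_on_imp_continuous_on[OF smooth[of 0]] s] r
    by (intro continuous_intros) auto
  have dF: "continuous_on K (\<lambda>u. frechet_derivative F (at (r *\<^sub>R sph u)) v $ i $ j)" for v i j
  proof -
    have "continuous_on V (\<lambda>x. frechet_derivative F (at x) v)" using smooth[of 1] by simp
    from continuous_on_compose2[OF this s] r show ?thesis by (intro continuous_intros) auto
  qed
  have C: "continuous_on K (\<lambda>u. christoffel_of F k i j (r *\<^sub>R sph u))" for k i j
    unfolding christoffel_of_def
    by (intro continuous_intros continuous_on_det_3 continuous_on_adj3 F dF) (simp add: nz)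
  have sc: "continuous_on K (\<lambda>u. sph u $ k)" for k by (intro continuous_intros continuous_on_sph)
  have B: "continuous_on K (\<lambda>u. curvature_matrix F r (sph u) $ i $ j)" for i j
    unfolding curvature_matrix_def
    by simp (intro continuous_intros C sc)
  have FB: "continuous_on K (\<lambda>u. (F (r *\<^sub>R sph u) + curvature_matrix F r (sph u)) $ i $ j)" for i j
    by simp (intro continuous_intros F B)
  show ?thesis
    unfolding hemisphere_density_def polar_form_def
    by (intro continuous_intros continuous_on_adjoint_form continuous_on_det_3 F B FB continuous_on_sph)
      (simp_all add: nz)
qed

end

section \<open>The Willmore integral of the coordinate hemisphere\<close>

context fermi_metric
begin

lemma hemisphere_willmore:
  assumes r: "0 < r" "r < \<epsilon>" and u: "u \<in> hemisphere_domain"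
    and pos: "det (F (r *\<^sub>R sph u)) > 0" "adjoint_form (F (r *\<^sub>R sph u)) (sph u) > 0"
  defines "X \<equiv> \<lambda>u. r *\<^sub>R sph u"
  defines "n \<equiv> inverse (sqrt (det (g (X u)) * adjoint_form (g (X u)) (sph u))) *\<^sub>R (adj3 (g (X u)) *v sph u)"
  shows "unit_normal g hemisphere_domain X u n"
    and "(mean_curvature S g hemisphere_domain X n u)\<^sup>2 * sqrt (det (first_form g hemisphere_domain X u))
       = sin (u $ 1) * hemisphere_density F r (sph u)"
proof -
  let ?D = "hemisphere_domain"
  have D: "open ?D" by (simp add: hemisphere_domain_def open_box)
  have v: "norm (X u) < \<epsilon>" using r by (simp add: X_def norm_sph)
  have "cos (u $ 1) \<ge> 0" using u by (intro cos_ge_zero) (auto simp: mem_hemisphere_domain)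
  then have v3: "X u $ 3 \<ge> 0" using r by (simp add: X_def sph_def)
  have s: "sin (u $ 1) > 0" using u by (intro sin_gt_zero) (auto simp: mem_hemisphere_domain)
  have gF: "g (X u) = F (X u)" using half_ballD(3)[OF v v3] by simp
  have tr: "transpose (g (X u)) = g (X u)" using sym half_ballD(1)[OF v v3] by simp
  have pos': "det (g (X u)) > 0" "adjoint_form (g (X u)) (sph u) > 0" using pos gF by (simp_all add: X_def)
  have P: "partial_on ?D X i u = r *\<^sub>R sph_tangent i u" for i
    unfolding X_def using D u by (rule partial_on_sph)
  have cross: "cross3 (partial_on ?D X 1 u) (partial_on ?D X 2 u) = (r\<^sup>2 * sin (u $ 1)) *\<^sub>R sph u"
    by (simp add: P cross_mult_left cross_mult_right cross_sph_tangent power2_eq_square)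
  have "mat 1 - r *\<^sub>R christoffel_contraction S g (sph u) (X u) = curvature_matrix F r (sph u)"
    using christoffel_g[OF v v3] pos(1)
    by (simp add: curvature_matrix_def christoffel_contraction_def X_def)
  then have Z: "cov_deriv S g ?D X i j u \<bullet> sph u
      = - inverse r * ip (curvature_matrix F r (sph u)) (partial_on ?D X i u) (partial_on ?D X j u)" for i j
    using cov_deriv_sph[OF D u r(1), of S g i j] unfolding X_def by simp
  have sg: "r\<^sup>2 * sin (u $ 1) > 0" using r s by simp
  note W = willmore_density[of g X u "sph u", OF tr pos' cross sg Z, folded n_def]
  show "unit_normal g ?D X u n" by (rule W(1))
  \<comment> \<open>\<kappa>^2 \<sigma> with \<kappa> = -1/r and \<sigma> = r^2 sin: the powers of r
    cancel exactly.\<close>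
  have "(- inverse r)\<^sup>2 * (r\<^sup>2 * sin (u $ 1)) = sin (u $ 1)"
    using r by (simp add: power2_eq_square field_simps)
  then show "(mean_curvature S g ?D X n u)\<^sup>2 * sqrt (det (first_form g ?D X u))
       = sin (u $ 1) * hemisphere_density F r (sph u)"
    unfolding W(2) hemisphere_density_def gF by (simp add: X_def)
qed

lemma hemisphere_integral_expansion:
  obtains W C where "C > 0" and
    "\<forall>\<^sub>F r in at_right 0. 0 < r \<and> r < \<epsilon> \<and> (\<forall>u. det (F (r *\<^sub>R sph u)) > 0 \<and> adjoint_form (F (r *\<^sub>R sph u)) (sph u) > 0) \<and>
      ((\<lambda>u. sin (u $ 1) * hemisphere_density F r (sph u)) has_integral W r) hemisphere_domain \<and>
      \<bar>W r - (8 * pi + 2 * pi * trace A * r)\<bar> \<le> C * r\<^sup>2"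
proof -
  let ?K = "cbox (vector [0, 0]) (vector [pi/2, 2 * pi]) :: (real^2) set"
  have w: "\<forall>u\<in>UNIV. norm (sph u) = 1" by (simp add: norm_sph)
  note X = expn_hemisphere_density[OF w]
  \<comment> \<open>Being within 1/2 of 1 makes the determinant and the adjoint form
    positive.\<close>
  have half: "(0::real) < 1/2" by simp
  obtain C where C: "C > 0" "\<forall>\<^sub>F r in at_right 0. \<forall>u\<in>UNIV. \<bar>hemisphere_density F r (sph u)
      - (4 + r * (8 * sph u $ 3 * ip A (sph u) (sph u)))\<bar> \<le> C * r\<^sup>2"
    by (rule expnE[OF X(1)]) (rule that)
  define f where "f = (\<lambda>r u. sin (u $ 1) * hemisphere_density F r (sph u))"
  define f0 where "f0 = (\<lambda>r u. sin (u $ 1) * (4 + r * (8 * sph u $ 3 * ip A (sph u) (sph u))))"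
  \<comment> \<open>The closed box provides compactness for integrability; the open domain gives the
    same integral.\<close>
  define W where "W = (\<lambda>r. integral ?K (f r))"
  have f0: "(f0 r has_integral 8 * pi + 2 * pi * trace A * r) ?K" for r
  proof -
    \<comment> \<open>Entries of \<open>A\<close> with an index 3 vanish, so only a binary quadratic
      form is integrated.\<close>
    have eq: "f0 r = (\<lambda>u. sin (u$1) * (4 + 8 * r * cos (u$1) *
       (A$1$1 * (sin (u$1) * cos (u$2))\<^sup>2 + (A$1$2 + A$2$1) * (sin (u$1) * cos (u$2)) * (sin (u$1) * sin (u$2))
         + A$2$2 * (sin (u$1) * sin (u$2))\<^sup>2)))"
      by (auto simp: f0_def fun_eq_iff ip_3 sum_3 normal sph_def algebra_simps power2_eq_square)
    have "continuous_on ?K (f0 r)" unfolding eq by (intro continuous_intros)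
    then have "f0 r integrable_on ?K" by (rule integrable_continuous)
    moreover have "integral ?K (f0 r) = 8 * pi + 2 * pi * trace A * r"
      unfolding eq hemisphere_integral using normal(1)[of 3] by (simp add: trace_def sum_3)
    ultimately show ?thesis by (simp add: has_integral_iff)
  qed
  have "\<forall>\<^sub>F r in at_right 0. 0 < r \<and> r < \<epsilon> \<and> (\<forall>u. det (F (r *\<^sub>R sph u)) > 0 \<and> adjoint_form (F (r *\<^sub>R sph u)) (sph u) > 0) \<and>
      (f r has_integral W r) hemisphere_domain \<and>
      \<bar>W r - (8 * pi + 2 * pi * trace A * r)\<bar> \<le> (C * measure lborel ?K + 1) * r\<^sup>2"
    using C(2) expn_near[OF X(2) half] expn_near[OF X(3) half] eventually_at_right_0_less[OF \<epsilon>(1)]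
  proof eventually_elim
    case (elim r)
    have pos: "det (F (r *\<^sub>R sph u)) > 0" "adjoint_form (F (r *\<^sub>R sph u)) (sph u) > 0" for u
      using elim(2,3)[rule_format, of u] by (simp_all add: abs_if split: if_splits)
    have "continuous_on ?K (f r)"
      unfolding f_def using elim half_ballD(2)
      by (intro continuous_intros continuous_on_hemisphere_density pos) (simp add: norm_sph)
    then have fi: "(f r has_integral W r) ?K"
      unfolding W_def by (intro integrable_integral integrable_continuous)
    have "norm (W r - (8 * pi + 2 * pi * trace A * r)) \<le> (C * r\<^sup>2) * measure lborel ?K"
    proof (rule has_integral_bound[OF _ has_integral_diff[OF fi f0]])
      show "0 \<le> C * r\<^sup>2" using C(1) by simp
      show "norm (f r u - f0 r u) \<le> C * r\<^sup>2" if "u \<in> ?K" for u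
      proof -
        have "\<bar>f r u - f0 r u\<bar> = \<bar>sin (u $ 1)\<bar> * \<bar>hemisphere_density F r (sph u)
          - (4 + r * (8 * sph u $ 3 * ip A (sph u) (sph u)))\<bar>"
          by (simp add: f_def f0_def right_diff_distrib flip: abs_mult)
        also have "\<dots> \<le> 1 * (C * r\<^sup>2)"
          using elim(1) by (intro mult_mono) auto
        finally show ?thesis by simp
      qed
    qed
    moreover have "(C * r\<^sup>2) * measure lborel ?K \<le> (C * measure lborel ?K + 1) * r\<^sup>2"
      by (simp add: algebra_simps)
    ultimately have "\<bar>W r - (8 * pi + 2 * pi * trace A * r)\<bar> \<le> (C * measure lborel ?K + 1) * r\<^sup>2"
      unfolding real_norm_def by (rule order_trans)
    then show ?case
      using elim(4) pos fi by (simp add: hemisphere_domain_def has_integral_open_interval)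
  qed
  moreover have "C * measure lborel ?K + 1 > 0" using C(1) by (simp add: add_nonneg_pos)
  ultimately show ?thesis using that unfolding f_def by blast
qed

end

theorem lemma4p2:
  fixes A :: "'a::{t2_space, second_countable_topology} chart set"
    and G :: "'a chart \<Rightarrow> real^3 \<Rightarrow> real^3^3"
    and q :: 'a
    and c :: "'a chart"
  assumes "riemannian_3_manifold A G"
    and "q \<in> manifold_boundary A"
    and "fermi_chart A G q c"
  shows "\<exists>W :: real \<Rightarrow> real.
      (\<forall>\<^sub>F r in at_right 0. has_willmore_integral G c (fermi_hemisphere c r) (W r)) \<and>
      (\<lambda>r. W r - (8 * pi - 4 * pi * boundary_mean_curvature G c q * r)) \<in> O[at_right 0](\<lambda>r. r\<^sup>2) \<and>
      (boundary_mean_curvature G c q > 0 \<longrightarrow> (\<forall>\<^sub>F r in at_right 0. W r < 8 * pi))"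
proof -
  have cA: "c \<in> A" and q: "snd c q = 0" using assms(3) by (auto simp: fermi_chart_def)
  have chart: "is_chart c"
    using assms(1) cA by (auto simp: riemannian_3_manifold_def smooth_structure_def)
  have "smooth_on (G c) (image_of c)" "\<And>x. x \<in> image_of c \<Longrightarrow> transpose (G c x) = G c x"
    using assms(1) cA by (auto simp: riemannian_3_manifold_def riemannian_metric_def)
  from fermi_metric_extension[OF chart assms(3) this] obtain F V \<epsilon>
    where "fermi_metric (image_of c) (G c) F V \<epsilon>" .
  then interpret fermi_metric "image_of c" "G c" F V \<epsilon> .
  define H where "H = boundary_mean_curvature G c q"
  have "bd_proj 0 = 0" by (simp add: bd_proj_def vec_eq_iff forall_2)
  then have H: "trace (frechet_derivative F (at 0) (axis 3 1)) = - 2 * H"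
    using boundary_mean_curvature_0
    by (simp add: H_def boundary_mean_curvature_def q bd_image_def)
  \<comment> \<open>Below \<epsilon> the whole half-sphere lies in the chart image, so the chart
    domain does not truncate the hemisphere.\<close>
  have image: "snd c ` fermi_hemisphere c r = {v. v $ 3 \<ge> 0 \<and> (v $ 1)\<^sup>2 + (v $ 2)\<^sup>2 + (v $ 3)\<^sup>2 = r\<^sup>2}"
    if r: "0 < r" "r < \<epsilon>" for r
  proof (intro equalityI subsetI)
    fix v :: "real^3" assume "v \<in> snd c ` fermi_hemisphere c r"
    then show "v \<in> {v. v $ 3 \<ge> 0 \<and> (v $ 1)\<^sup>2 + (v $ 2)\<^sup>2 + (v $ 3)\<^sup>2 = r\<^sup>2}"
      using S_half_space by (auto simp: fermi_hemisphere_def image_of_def half_space_def)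
  next
    fix v :: "real^3" assume v: "v \<in> {v. v $ 3 \<ge> 0 \<and> (v $ 1)\<^sup>2 + (v $ 2)\<^sup>2 + (v $ 3)\<^sup>2 = r\<^sup>2}"
    then have "norm v = r" using r by (simp add: norm_vec_def L2_set_def sum_3)
    then have "v \<in> image_of c" using half_ballD(1) v r by simp
    then show "v \<in> snd c ` fermi_hemisphere c r"
      using v by (auto simp: image_of_def fermi_hemisphere_def)
  qed
  obtain W C where C: "C > 0" and W:
    "\<forall>\<^sub>F r in at_right 0. 0 < r \<and> r < \<epsilon> \<and> (\<forall>u. det (F (r *\<^sub>R sph u)) > 0 \<and> adjoint_form (F (r *\<^sub>R sph u)) (sph u) > 0) \<and>
      ((\<lambda>u. sin (u $ 1) * hemisphere_density F r (sph u)) has_integral W r) hemisphere_domain \<and>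
      \<bar>W r - (8 * pi + 2 * pi * trace (frechet_derivative F (at 0) (axis 3 1)) * r)\<bar> \<le> C * r\<^sup>2"
    by (rule hemisphere_integral_expansion) (rule that)
  have bound: "\<forall>\<^sub>F r in at_right 0. 0 < r \<and> \<bar>W r - (8 * pi - 4 * pi * H * r)\<bar> \<le> C * r\<^sup>2"
    using W by eventually_elim (simp add: H mult.assoc)
  show ?thesis
    unfolding H_def[symmetric]
  proof (intro exI[of _ W] conjI impI)
    show "\<forall>\<^sub>F r in at_right 0. has_willmore_integral G c (fermi_hemisphere c r) (W r)"
      using W
    proof eventually_elim
      case (elim r)
      let ?X = "\<lambda>u. r *\<^sub>R sph u"
      define n where "n = (\<lambda>u. inverse (sqrt (det (G c (?X u)) * adjoint_form (G c (?X u)) (sph u))) *\<^sub>R (adj3 (G c (?X u)) *v sph u))"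
      have r: "0 < r" "r < \<epsilon>" using elim by auto
      have hw: "unit_normal (G c) hemisphere_domain ?X u (n u)"
        "(mean_curvature (image_of c) (G c) hemisphere_domain ?X (n u) u)\<^sup>2 * sqrt (det (first_form (G c) hemisphere_domain ?X u))
         = sin (u $ 1) * hemisphere_density F r (sph u)" if "u \<in> hemisphere_domain" for u
        using hemisphere_willmore[OF r that] elim by (auto simp: n_def)
      have "((\<lambda>u. (mean_curvature (image_of c) (G c) hemisphere_domain ?X (n u) u)\<^sup>2 * sqrt (det (first_form (G c) hemisphere_domain ?X u)))
           has_integral W r) hemisphere_domain"
        using elim hw(2) by (subst has_integral_cong[where g="\<lambda>u. sin (u $ 1) * hemisphere_density F r (sph u)"]) auto
      then show ?case
        unfolding has_willmore_integral_def image[OF r]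
        using parametrizes_hemisphere[OF r(1)] hw(1)
        by (auto simp: fermi_hemisphere_def)
    qed
    show "(\<lambda>r. W r - (8 * pi - 4 * pi * H * r)) \<in> O[at_right 0](\<lambda>r. r\<^sup>2)"
      by (rule bigoI[of _ C]) (use bound in \<open>eventually_elim, simp\<close>)
    assume "H > 0"
    then have "4 * pi * H / C > 0" using C by simp
    from eventually_at_right_0_less[OF this] bound show "\<forall>\<^sub>F r in at_right 0. W r < 8 * pi"
    proof eventually_elim
      case (elim r)
      have "C * r < 4 * pi * H" using elim C by (simp add: field_simps)
      then have "C * r * r < 4 * pi * H * r" using elim by (intro mult_strict_right_mono) auto
      then have "C * r\<^sup>2 < 4 * pi * H * r" by (simp add: power2_eq_square mult.assoc)
      moreover have "W r - (8 * pi - 4 * pi * H * r) \<le> C * r\<^sup>2" using elim by linarith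
      ultimately show ?case by linarith
    qed
  qed
qed

end
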